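(* Let $f=(f_1,\ldots,f_m)$ be a contractive free holomorphic function with $\|f(0)\|<1$ such that the boundary functions $\widetilde f_1,\ldots,\widetilde f_m$ are in the noncommutative disc algebra $\mathcal A_n$. If $(T_1,\ldots,T_n)\in B(\mathcal H)^n$ and the joint spectral radius satisfies $r(T_1,\ldots,T_n)<1$, then $$r(f(T_1,\ldots,T_n))<1.$$
   Context: Let $n,m\ge1$, $\mathcal H$ a complex Hilbert space, $\mathcal K$ a separable infinite-dimensional Hilbert space. $\mathbb F_n^+$ is the unital free semigroup on generators $g_1,\ldots,g_n$ with identity $g_0$; $|\alpha|$ is the length of $\alpha$. $T_\alpha:=T_{i_1}\cdots T_{i_k}$ if $\alpha=g_{i_1}\cdots g_{i_k}$, $T_{g_0}:=I$. For any number $n$ of operators, the joint spectral radius is $r(T_1,\ldots,T_n):=\lim_{k\to\infty}\big\|\sum_{\alpha\in\mathbb F_n^+,|\alpha|=k}T_\alpha T_\alpha^*\big\|^{1/2k}$. $[B(\mathcal K)^n]_1:=\{X\in B(\mathcal K)^n:\|\sum_iX_iX_i^*\|<1\}$. Each $f_j(X)=\sum_{k=0}^\infty\sum_{|\alpha|=k}a_\alpha^{(j)}X_\alpha$ ($a^{(j)}_\alpha\in\mathbb C$, $\limsup_k(\sum_{|\alpha|=k}|a_\alpha^{(j)}|^2)^{1/2k}\le1$) is a free holomorphic function on $[B(\mathcal K)^n]_1$; $f$ is contractive if the row operator $[f_1(X)\ \cdots\ f_m(X)]$ has norm at most $1$ for all $X\in[B(\mathcal K)^n]_1$. $f(0)=(f_1(0),\ldots,f_m(0))$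 has norm the Euclidean norm in $\mathbb C^m$. $S_i\varphi:=e_i\otimes\varphi$ are the left creation operators on the full Fock space $F^2(H_n)=\mathbb C1\oplus\bigoplus_{k\ge1}H_n^{\otimes k}$ ($e_1,\ldots,e_n$ an orthonormal basis of the $n$-dimensional Hilbert space $H_n$), and $\mathcal A_n$ is the norm closed algebra generated by $S_1,\ldots,S_n,I$. The boundary function of $f_j$ is $\widetilde f_j=\lim_{r\to1}f_j(rS_1,\ldots,rS_n)$; $\widetilde f_j\in\mathcal A_n$ means that this limit exists in operator norm. For $T$ with $r(T)<1$, $f(T)=(f_1(T),\ldots,f_m(T))\in B(\mathcal H)^m$ with $f_j(T)=\sum_{k=0}^\infty\sum_{|\alpha|=k}a_\alpha^{(j)}T_\alpha$ (norm convergent in $k$). *)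

theory Defs
  imports "HOL-Analysis.Analysis"
begin

section \<open>Complex Hilbert spaces\<close>

text \<open>The underlying real Hilbert space has inner product \<open>Re \<langle>x, y\<rangle>\<close>, so its norm is the usual
  one, \<open>\<parallel>x\<parallel> = sqrt \<langle>x, x\<rangle>\<close>. The complex inner product is linear in the first argument.\<close>

class complex_hilbert = real_inner + complete_space +
  fixes scaleC :: "complex \<Rightarrow> 'a \<Rightarrow> 'a" (infixr "*\<^sub>C" 75)
    and cinner :: "'a \<Rightarrow> 'a \<Rightarrow> complex"
  assumes scaleC_add_right: "c *\<^sub>C (x + y) = c *\<^sub>C x + c *\<^sub>C y"
    and scaleC_add_left: "(c + d) *\<^sub>C x = c *\<^sub>C x + d *\<^sub>C x"
    and scaleC_scaleC: "c *\<^sub>C (d *\<^sub>C x) = (c * d) *\<^sub>C x"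
    and scaleC_of_real: "complex_of_real r *\<^sub>C x = r *\<^sub>R x"
    and cinner_commute: "cinner x y = cnj (cinner y x)"
    and cinner_add_left: "cinner (x + y) z = cinner x z + cinner y z"
    and cinner_scaleC_left: "cinner (c *\<^sub>C x) y = c * cinner x y"
    and inner_eq_Re_cinner: "inner x y = Re (cinner x y)"

lemma cinner_self: "cinner x x = complex_of_real ((norm x)\<^sup>2)"
  using cinner_commute[of x x] by (simp add: complex_eq_iff power2_norm_eq_inner inner_eq_Re_cinner)

lemma norm_scaleC: "norm (c *\<^sub>C x) = cmod c * norm x"
proof -
  have "cinner (c *\<^sub>C x) (c *\<^sub>C x) = c * cnj c * cinner x x"
    by (metis cinner_commute cinner_scaleC_left complex_cnj_mult mult.assoc complex_cnj_cnj)
  then have "complex_of_real ((norm (c *\<^sub>C x))\<^sup>2) = complex_of_real ((cmod c * norm x)\<^sup>2)"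
    by (simp only: cinner_self complex_norm_square[symmetric] power_mult_distrib of_real_mult)
  then have "(norm (c *\<^sub>C x))\<^sup>2 = (cmod c * norm x)\<^sup>2"
    using of_real_eq_iff by blast
  then show ?thesis
    by (rule power2_eq_imp_eq) auto
qed

lemma bounded_linear_scaleC: "bounded_linear (\<lambda>x::'a::complex_hilbert. c *\<^sub>C x)"
  by (rule bounded_linear_intro[where K = "cmod c"])
    (simp_all add: scaleC_add_right norm_scaleC mult.commute scaleC_scaleC flip: scaleC_of_real)

lemma vector_space_scaleC: "vector_space ((*\<^sub>C) :: complex \<Rightarrow> 'a::complex_hilbert \<Rightarrow> 'a)"
  using scaleC_of_real[of 1]
  by unfold_locales (simp_all add: scaleC_add_right scaleC_add_left scaleC_scaleC)

definition infinite_dimensional :: "'a::complex_hilbert itself \<Rightarrow> bool" where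
  "infinite_dimensional _ \<longleftrightarrow> \<not> (\<exists>B::'a set. finite B \<and> module.span (*\<^sub>C) B = UNIV)"


section \<open>Bounded operators\<close>

text \<open>\<open>B(\<H>)\<close> consists of the \<open>A :: 'h \<Rightarrow>\<^sub>L 'h\<close> with \<open>complex_linear A\<close>; type \<open>\<Rightarrow>\<^sub>L\<close> itself only
  requires real linearity.\<close>

definition complex_linear :: "('a::complex_hilbert \<Rightarrow>\<^sub>L 'b::complex_hilbert) \<Rightarrow> bool" where
  "complex_linear A \<longleftrightarrow> (\<forall>c x. blinfun_apply A (c *\<^sub>C x) = c *\<^sub>C blinfun_apply A x)"

text \<open>The operator \<open>c I\<close>.\<close>

lift_definition scalar_op :: "complex \<Rightarrow> 'a::complex_hilbert \<Rightarrow>\<^sub>L 'a" is "\<lambda>c x. c *\<^sub>C x"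
  by (rule bounded_linear_scaleC)

text \<open>The Hilbert space adjoint; it exists for complex linear \<open>A\<close> by the Riesz representation theorem.\<close>

definition adj :: "('a::complex_hilbert \<Rightarrow>\<^sub>L 'b::complex_hilbert) \<Rightarrow> 'b \<Rightarrow>\<^sub>L 'a" where
  "adj A = (THE B. \<forall>x y. cinner (blinfun_apply A x) y = cinner x (blinfun_apply B y))"

text \<open>Words over \<open>'n\<close> are the elements of the free semigroup on \<open>CARD('n)\<close> generators.\<close>

primrec op_word :: "('n \<Rightarrow> 'a \<Rightarrow>\<^sub>L 'a::complex_hilbert) \<Rightarrow> 'n list \<Rightarrow> 'a \<Rightarrow>\<^sub>L 'a" where
  "op_word T [] = id_blinfun"
| "op_word T (i # \<alpha>) = T i o\<^sub>L op_word T \<alpha>"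

text \<open>By submultiplicativity the limit exists for every tuple in \<open>B(\<H>)\<close>; the term for \<open>k = 0\<close>
  (where \<^const>\<open>root\<close> \<open>0\<close> is the zero function) does not affect it.\<close>

definition joint_spectral_radius :: "('n::finite \<Rightarrow> 'a \<Rightarrow>\<^sub>L 'a::complex_hilbert) \<Rightarrow> real" where
  "joint_spectral_radius T =
    lim (\<lambda>k. root (2 * k) (norm (\<Sum>\<alpha> | length \<alpha> = k. op_word T \<alpha> o\<^sub>L adj (op_word T \<alpha>))))"

definition op_unit_ball :: "('n::finite \<Rightarrow> 'a \<Rightarrow>\<^sub>L 'a::complex_hilbert) set" where
  "op_unit_ball = {X. (\<forall>i. complex_linear (X i)) \<and> norm (\<Sum>i\<in>UNIV. X i o\<^sub>L adj (X i)) < 1}"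

text \<open>\<open>'a ^ 'm\<close> carries the Hilbert space norm of the direct sum of \<open>CARD('m)\<close> copies of \<open>'a\<close>.\<close>

lift_definition row_operator ::
  "('m::finite \<Rightarrow> 'a::complex_hilbert \<Rightarrow>\<^sub>L 'b::complex_hilbert) \<Rightarrow> ('a ^ 'm) \<Rightarrow>\<^sub>L 'b"
  is "\<lambda>F v. \<Sum>j\<in>UNIV. F j (v $ j)"
  by (intro bounded_linear_sum bounded_linear_compose[OF _ bounded_linear_vec_nth]) auto


section \<open>Free holomorphic functions\<close>

text \<open>A free holomorphic function is represented by its coefficient family.\<close>

definition free_holomorphic :: "('n::finite list \<Rightarrow> complex) \<Rightarrow> bool" where
  "free_holomorphic a \<longleftrightarrow>
    limsup (\<lambda>k. ereal (root (2 * k) (\<Sum>\<alpha> | length \<alpha> = k. (cmod (a \<alpha>))\<^sup>2))) \<le> 1"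

definition free_eval ::
  "('n::finite list \<Rightarrow> complex) \<Rightarrow> ('n \<Rightarrow> 'a \<Rightarrow>\<^sub>L 'a::complex_hilbert) \<Rightarrow> 'a \<Rightarrow>\<^sub>L 'a" where
  "free_eval a X = (\<Sum>k. \<Sum>\<alpha> | length \<alpha> = k. scalar_op (a \<alpha>) o\<^sub>L op_word X \<alpha>)"

text \<open>\<open>f(0) = a\<^bsub>[]\<^esub> I\<close> is identified with the scalar \<open>a\<^bsub>[]\<^esub>\<close>.\<close>

lemma free_eval_zero: "free_eval a (\<lambda>_. 0 :: 'h \<Rightarrow>\<^sub>L 'h::complex_hilbert) = scalar_op (a [])"
proof -
  have w: "op_word (\<lambda>_. 0 :: 'h \<Rightarrow>\<^sub>L 'h) \<alpha> = (if \<alpha> = [] then id_blinfun else 0)" for \<alpha> :: "'a list"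
    by (cases \<alpha>) (auto intro: blinfun_eqI)
  have "(\<Sum>\<alpha> | length \<alpha> = k. scalar_op (a \<alpha>) o\<^sub>L op_word (\<lambda>_. 0 :: 'h \<Rightarrow>\<^sub>L 'h) \<alpha>)
      = (if k = 0 then scalar_op (a []) else 0)" for k
  proof (cases "k = 0")
    case True
    then show ?thesis
      by (auto intro: blinfun_eqI)
  next
    case False
    then have "(\<Sum>\<alpha> | length \<alpha> = k. scalar_op (a \<alpha>) o\<^sub>L op_word (\<lambda>_. 0 :: 'h \<Rightarrow>\<^sub>L 'h) \<alpha>) = 0"
      by (intro sum.neutral) (auto simp: w)
    with False show ?thesis
      by simp
  qed
  then show ?thesis
    unfolding free_eval_def by (subst suminf_finite[where N = "{0}"]) (auto intro: blinfun_eqI)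
qed

definition value_at_zero :: "('m::finite \<Rightarrow> 'n list \<Rightarrow> complex) \<Rightarrow> complex ^ 'm" where
  "value_at_zero f = (\<chi> j. f j [])"

definition contractive ::
  "'k::complex_hilbert itself \<Rightarrow> ('m::finite \<Rightarrow> 'n::finite list \<Rightarrow> complex) \<Rightarrow> bool" where
  "contractive _ f \<longleftrightarrow>
    (\<forall>X \<in> (op_unit_ball :: ('n \<Rightarrow> 'k \<Rightarrow>\<^sub>L 'k) set). norm (row_operator (\<lambda>j. free_eval (f j) X)) \<le> 1)"


section \<open>The Hilbert space of square-summable families\<close>

typedef 'i ell2 = "{x :: 'i \<Rightarrow> complex. (\<lambda>i. (cmod (x i))\<^sup>2) summable_on UNIV}"
  morphisms coord Abs_ell2
  by (rule exI[of _ "\<lambda>_. 0"]) simp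

setup_lifting type_definition_ell2

lemma sq_summable_add:
  assumes "(\<lambda>i. (cmod (x i))\<^sup>2) summable_on A" "(\<lambda>i. (cmod (y i))\<^sup>2) summable_on A"
  shows "(\<lambda>i. (cmod (x i + y i))\<^sup>2) summable_on A"
proof (rule summable_on_comparison_test)
  show "(\<lambda>i. 2 * (cmod (x i))\<^sup>2 + 2 * (cmod (y i))\<^sup>2) summable_on A"
    using assms by (intro summable_on_add summable_on_cmult_right)
  show "(cmod (x i + y i))\<^sup>2 \<le> 2 * (cmod (x i))\<^sup>2 + 2 * (cmod (y i))\<^sup>2" for i
  proof -
    have "(cmod (x i + y i))\<^sup>2 \<le> (cmod (x i) + cmod (y i))\<^sup>2"
      by (simp add: norm_triangle_ineq power_mono)
    also have "\<dots> \<le> 2 * (cmod (x i))\<^sup>2 + 2 * (cmod (y i))\<^sup>2"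
      using sum_squares_bound[of "cmod (x i)" "cmod (y i)"] by (simp add: power2_sum)
    finally show ?thesis .
  qed
qed auto

lemma sq_summable_mult:
  assumes "(\<lambda>i. (cmod (x i))\<^sup>2) summable_on A"
  shows "(\<lambda>i. (cmod (c * x i))\<^sup>2) summable_on A"
  using summable_on_cmult_right[OF assms, of "(cmod c)\<^sup>2"]
  by (simp add: norm_mult power_mult_distrib)

lemma sq_summable_prod:
  assumes "(\<lambda>i. (cmod (x i))\<^sup>2) summable_on A" "(\<lambda>i. (cmod (y i))\<^sup>2) summable_on A"
  shows "(\<lambda>i. x i * cnj (y i)) summable_on A"
proof (rule abs_summable_summable, rule summable_on_comparison_test)
  show "(\<lambda>i. (cmod (x i))\<^sup>2 + (cmod (y i))\<^sup>2) summable_on A"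
    using assms by (rule summable_on_add)
  show "norm (x i * cnj (y i)) \<le> (cmod (x i))\<^sup>2 + (cmod (y i))\<^sup>2" for i
  proof -
    have "0 \<le> cmod (x i) * cmod (y i)"
      by simp
    then show ?thesis
      using sum_squares_bound[of "cmod (x i)" "cmod (y i)"] by (simp only: norm_mult complex_mod_cnj)
  qed
qed auto

instantiation ell2 :: (type) real_inner
begin

lift_definition zero_ell2 :: "'a ell2" is "\<lambda>_. 0" by simp
lift_definition plus_ell2 :: "'a ell2 \<Rightarrow> 'a ell2 \<Rightarrow> 'a ell2" is "\<lambda>x y i. x i + y i"
  by (rule sq_summable_add)
lift_definition uminus_ell2 :: "'a ell2 \<Rightarrow> 'a ell2" is "\<lambda>x i. - x i" by simp
lift_definition minus_ell2 :: "'a ell2 \<Rightarrow> 'a ell2 \<Rightarrow> 'a ell2" is "\<lambda>x y i. x i - y i"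
  using sq_summable_add[where y = "\<lambda>i. - y i" for y] by fastforce
lift_definition scaleR_ell2 :: "real \<Rightarrow> 'a ell2 \<Rightarrow> 'a ell2" is "\<lambda>r x i. complex_of_real r * x i"
  by (rule sq_summable_mult)
lift_definition inner_ell2 :: "'a ell2 \<Rightarrow> 'a ell2 \<Rightarrow> real"
  is "\<lambda>x y. Re (\<Sum>\<^sub>\<infinity>i. x i * cnj (y i))" .

definition norm_ell2 :: "'a ell2 \<Rightarrow> real" where
  "norm_ell2 x = sqrt (inner x x)"
definition sgn_ell2 :: "'a ell2 \<Rightarrow> 'a ell2" where
  "sgn_ell2 x = scaleR (inverse (norm x)) x"
definition dist_ell2 :: "'a ell2 \<Rightarrow> 'a ell2 \<Rightarrow> real" where
  "dist_ell2 x y = norm (x - y)"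
definition uniformity_ell2 :: "('a ell2 \<times> 'a ell2) filter" where
  "uniformity_ell2 = (INF e\<in>{0<..}. principal {(x, y). dist x y < e})"
definition open_ell2 :: "'a ell2 set \<Rightarrow> bool" where
  "open_ell2 U \<longleftrightarrow> (\<forall>x\<in>U. \<forall>\<^sub>F (x', y) in uniformity. x' = x \<longrightarrow> y \<in> U)"

lemma coord_summable: "(\<lambda>i. (cmod (coord x i))\<^sup>2) summable_on UNIV"
  using coord[of x] by simp

lemma inner_self_ell2: "inner x x = (\<Sum>\<^sub>\<infinity>i. (cmod (coord x i))\<^sup>2)" for x :: "'a ell2"
proof -
  have "(\<Sum>\<^sub>\<infinity>i. coord x i * cnj (coord x i)) = (\<Sum>\<^sub>\<infinity>i. complex_of_real ((cmod (coord x i))\<^sup>2))"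
    by (simp only: complex_norm_square)
  also have "\<dots> = complex_of_real (\<Sum>\<^sub>\<infinity>i. (cmod (coord x i))\<^sup>2)"
    by (rule infsumI, rule has_sum_of_real, rule has_sum_infsum, rule coord_summable)
  finally show ?thesis
    by (simp add: inner_ell2.rep_eq)
qed

instance
proof (intro_classes)
  fix x y z :: "'a ell2" and r s :: real
  show "x + y + z = x + (y + z)" "x + y = y + x" "0 + x = x" "- x + x = 0" "x - y = x + - y"
    by (transfer; simp add: algebra_simps)+
  show "r *\<^sub>R (x + y) = r *\<^sub>R x + r *\<^sub>R y" "(r + s) *\<^sub>R x = r *\<^sub>R x + s *\<^sub>R x"
    "r *\<^sub>R (s *\<^sub>R x) = (r * s) *\<^sub>R x" "1 *\<^sub>R x = x"
    by (transfer; simp add: algebra_simps)+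
  show "sgn x = inverse (norm x) *\<^sub>R x" "dist x y = norm (x - y)" "norm x = sqrt (inner x x)"
    by (fact sgn_ell2_def dist_ell2_def norm_ell2_def)+
  show "(uniformity :: ('a ell2 \<times> 'a ell2) filter) = (INF e\<in>{0<..}. principal {(x, y). dist x y < e})"
    by (fact uniformity_ell2_def)
  show "open U \<longleftrightarrow> (\<forall>x\<in>U. \<forall>\<^sub>F (x', y) in uniformity. x' = x \<longrightarrow> y \<in> U)" for U :: "'a ell2 set"
    by (fact open_ell2_def)
  show "inner x y = inner y x"
  proof transfer
    fix x y :: "'a \<Rightarrow> complex"
    have "(\<Sum>\<^sub>\<infinity>i. x i * cnj (y i)) = cnj (\<Sum>\<^sub>\<infinity>i. y i * cnj (x i))"
      by (simp add: mult.commute flip: infsum_cnj)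
    then show "Re (\<Sum>\<^sub>\<infinity>i. x i * cnj (y i)) = Re (\<Sum>\<^sub>\<infinity>i. y i * cnj (x i))"
      by simp
  qed
  show "inner (x + y) z = inner x z + inner y z"
    by transfer (simp add: distrib_right infsum_add sq_summable_prod)
  show "inner (r *\<^sub>R x) y = r * inner x y"
    by transfer (simp add: mult.assoc infsum_cmult_right sq_summable_prod)
  show "0 \<le> inner x x"
    by (simp add: inner_self_ell2 infsum_nonneg)
  show "inner x x = 0 \<longleftrightarrow> x = 0"
  proof
    assume "inner x x = 0"
    then have "(cmod (coord x i))\<^sup>2 = 0" for i
      using nonneg_infsum_le_0D[OF _ coord_summable[of x], of i] by (simp add: inner_self_ell2)
    then show "x = 0"
      by transfer auto
  next
    assume "x = 0"
    then show "inner x x = 0"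
      by (simp add: inner_self_ell2 zero_ell2.rep_eq)
  qed
qed

end

lemma norm_sq_ell2: "(norm x)\<^sup>2 = (\<Sum>\<^sub>\<infinity>i. (cmod (coord x i))\<^sup>2)"
  by (simp add: power2_norm_eq_inner inner_self_ell2)

lemma sum_coord_le_norm_sq: "finite F \<Longrightarrow> (\<Sum>i\<in>F. (cmod (coord x i))\<^sup>2) \<le> (norm x)\<^sup>2"
  unfolding norm_sq_ell2 by (rule finite_sum_le_infsum[OF coord_summable]) auto

lemma cmod_coord_le_norm: "cmod (coord x i) \<le> norm x"
  using sum_coord_le_norm_sq[of "{i}" x] by (simp add: power2_le_iff_abs_le)

instance ell2 :: (type) complete_space
proof
  fix X :: "nat \<Rightarrow> 'a ell2"
  assume X: "Cauchy X"
  have "Cauchy (\<lambda>n. coord (X n) i)" for i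
  proof (rule metric_CauchyI)
    fix e :: real assume "0 < e"
    then obtain M where M: "\<And>m n. m \<ge> M \<Longrightarrow> n \<ge> M \<Longrightarrow> dist (X m) (X n) < e"
      using metric_CauchyD[OF X] by blast
    have "dist (coord (X m) i) (coord (X n) i) \<le> dist (X m) (X n)" for m n
      using cmod_coord_le_norm[of "X m - X n" i] by (simp add: dist_norm minus_ell2.rep_eq)
    then show "\<exists>M. \<forall>m\<ge>M. \<forall>n\<ge>M. dist (coord (X m) i) (coord (X n) i) < e"
      using M le_less_trans by blast
  qed
  then have "\<exists>l. (\<lambda>n. coord (X n) i) \<longlonglongrightarrow> l" for i
    using Cauchy_convergent_iff convergent_def by blast
  then obtain l where l: "\<And>i. (\<lambda>n. coord (X n) i) \<longlonglongrightarrow> l i"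
    by metis
  have tail: "\<exists>M. \<forall>m\<ge>M. \<forall>F. finite F \<longrightarrow> (\<Sum>i\<in>F. (cmod (coord (X m) i - l i))\<^sup>2) \<le> e\<^sup>2"
    if "0 < e" for e
  proof -
    obtain M where M: "\<And>m n. m \<ge> M \<Longrightarrow> n \<ge> M \<Longrightarrow> dist (X m) (X n) < e"
      using metric_CauchyD[OF X \<open>0 < e\<close>] by blast
    have "(\<Sum>i\<in>F. (cmod (coord (X m) i - l i))\<^sup>2) \<le> e\<^sup>2" if "M \<le> m" "finite F" for m F
    proof (rule LIMSEQ_le_const2)
      show "(\<lambda>n. \<Sum>i\<in>F. (cmod (coord (X m) i - coord (X n) i))\<^sup>2)
          \<longlonglongrightarrow> (\<Sum>i\<in>F. (cmod (coord (X m) i - l i))\<^sup>2)"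
        by (intro tendsto_intros l)
      have "(\<Sum>i\<in>F. (cmod (coord (X m) i - coord (X n) i))\<^sup>2) \<le> e\<^sup>2" if "M \<le> n" for n
      proof -
        have "(\<Sum>i\<in>F. (cmod (coord (X m) i - coord (X n) i))\<^sup>2) \<le> (norm (X m - X n))\<^sup>2"
          using sum_coord_le_norm_sq[OF \<open>finite F\<close>, of "X m - X n"] by (simp add: minus_ell2.rep_eq)
        also have "\<dots> \<le> e\<^sup>2"
          using M[OF \<open>M \<le> m\<close> that] by (intro power_mono) (auto simp: dist_norm)
        finally show ?thesis .
      qed
      then show "\<exists>N. \<forall>n\<ge>N. (\<Sum>i\<in>F. (cmod (coord (X m) i - coord (X n) i))\<^sup>2) \<le> e\<^sup>2"
        by blast
    qed
    then show ?thesis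
      by blast
  qed
  have summ: "(\<lambda>i. (cmod (coord (X m) i - l i))\<^sup>2) summable_on UNIV"
    if "\<forall>F. finite F \<longrightarrow> (\<Sum>i\<in>F. (cmod (coord (X m) i - l i))\<^sup>2) \<le> e\<^sup>2" for m e
    by (rule nonneg_bdd_above_summable_on) (use that in \<open>auto intro!: bdd_aboveI2\<close>)
  obtain M where "\<forall>F. finite F \<longrightarrow> (\<Sum>i\<in>F. (cmod (coord (X M) i - l i))\<^sup>2) \<le> 1\<^sup>2"
    using tail[of 1] by auto
  then have "(\<lambda>i. (cmod (- (coord (X M) i - l i) + coord (X M) i))\<^sup>2) summable_on UNIV"
    using summ coord_summable by (intro sq_summable_add) (simp_all only: norm_minus_cancel, blast)
  then have "(\<lambda>i. (cmod (l i))\<^sup>2) summable_on UNIV"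
    by simp
  then obtain L where L: "coord L = l"
    using Abs_ell2_inverse by blast
  have "X \<longlonglongrightarrow> L"
  proof (rule metric_LIMSEQ_I)
    fix e :: real assume "0 < e"
    then obtain M where M: "\<And>m F. m \<ge> M \<Longrightarrow> finite F \<Longrightarrow>
        (\<Sum>i\<in>F. (cmod (coord (X m) i - l i))\<^sup>2) \<le> (e / 2)\<^sup>2"
      using tail[of "e / 2"] by auto
    have "dist (X m) L < e" if "M \<le> m" for m
    proof -
      have "(norm (X m - L))\<^sup>2 \<le> (e / 2)\<^sup>2"
        unfolding norm_sq_ell2
        by (rule infsum_le_finite_sums[OF coord_summable])
          (use M[OF that] in \<open>simp add: minus_ell2.rep_eq L\<close>)
      then have "norm (X m - L) \<le> e / 2"
        using \<open>0 < e\<close> by (simp add: power2_le_iff_abs_le)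
      then show ?thesis
        using \<open>0 < e\<close> by (simp add: dist_norm)
    qed
    then show "\<exists>M. \<forall>m\<ge>M. dist (X m) L < e"
      by blast
  qed
  then show "convergent X"
    by (auto simp: convergent_def)
qed

instantiation ell2 :: (type) complex_hilbert
begin

lift_definition scaleC_ell2 :: "complex \<Rightarrow> 'a ell2 \<Rightarrow> 'a ell2" is "\<lambda>c x i. c * x i"
  by (rule sq_summable_mult)
lift_definition cinner_ell2 :: "'a ell2 \<Rightarrow> 'a ell2 \<Rightarrow> complex"
  is "\<lambda>x y. \<Sum>\<^sub>\<infinity>i. x i * cnj (y i)" .

instance
proof (intro_classes)
  fix x y z :: "'a ell2" and c d :: complex and r :: real
  show "c *\<^sub>C (x + y) = c *\<^sub>C x + c *\<^sub>C y" "(c + d) *\<^sub>C x = c *\<^sub>C x + d *\<^sub>C x"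
    "c *\<^sub>C (d *\<^sub>C x) = (c * d) *\<^sub>C x" "complex_of_real r *\<^sub>C x = r *\<^sub>R x"
    by (transfer; simp add: algebra_simps)+
  show "cinner x y = cnj (cinner y x)"
    by transfer (simp add: mult.commute flip: infsum_cnj)
  show "cinner (x + y) z = cinner x z + cinner y z"
    by transfer (simp add: distrib_right infsum_add sq_summable_prod)
  show "cinner (c *\<^sub>C x) y = c * cinner x y"
    by transfer (simp add: mult.assoc infsum_cmult_right sq_summable_prod)
  show "inner x y = Re (cinner x y)"
    by transfer simp
qed

end


section \<open>The full Fock space and the noncommutative disc algebra\<close>

text \<open>The full Fock space on an \<open>n\<close>-dimensional space \<open>H\<^sub>n\<close> with orthonormal basis \<open>(e\<^sub>i)\<close> has the
  orthonormal basis \<open>e\<^sub>\<alpha> = e\<^bsub>i1\<^esub> \<otimes> \<dots> \<otimes> e\<^bsub>ik\<^esub>\<close> indexed by the words \<open>\<alpha>\<close> (the empty word giving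
  the vacuum vector); a vector is represented by its coordinates in this basis. A basis vector
  \<open>e\<^sub>i \<otimes> e\<^sub>\<alpha>\<close> is then \<open>e\<^bsub>i # \<alpha>\<^esub>\<close>.\<close>

type_synonym 'n fock = "'n list ell2"

lift_definition tensor_left :: "'n \<Rightarrow> 'n fock \<Rightarrow> 'n fock"
  is "\<lambda>i \<phi> \<alpha>. case \<alpha> of [] \<Rightarrow> 0 | j # \<beta> \<Rightarrow> if j = i then \<phi> \<beta> else 0"
proof -
  fix i :: 'n and \<phi> :: "'n list \<Rightarrow> complex"
  let ?\<psi> = "\<lambda>\<alpha>. case \<alpha> of [] \<Rightarrow> 0 | j # \<beta> \<Rightarrow> if j = i then \<phi> \<beta> else 0"
  assume "(\<lambda>\<beta>. (cmod (\<phi> \<beta>))\<^sup>2) summable_on UNIV"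
  then have "(\<lambda>\<alpha>. (cmod (?\<psi> \<alpha>))\<^sup>2) summable_on range ((#) i)"
    by (subst summable_on_reindex) (auto simp: o_def)
  then show "(\<lambda>\<alpha>. (cmod (?\<psi> \<alpha>))\<^sup>2) summable_on UNIV"
    by (rule summable_on_cong_neutral[THEN iffD1, rotated -1]) (auto split: list.splits)
qed

lemma norm_tensor_left: "norm (tensor_left i \<phi>) = norm \<phi>"
proof -
  have "(norm (tensor_left i \<phi>))\<^sup>2 = (\<Sum>\<^sub>\<infinity>\<alpha>\<in>range ((#) i). (cmod (coord (tensor_left i \<phi>) \<alpha>))\<^sup>2)"
    unfolding norm_sq_ell2
    by (rule infsum_cong_neutral) (auto simp: tensor_left.rep_eq split: list.splits)
  also have "\<dots> = (norm \<phi>)\<^sup>2"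
    by (subst infsum_reindex) (auto simp: o_def tensor_left.rep_eq norm_sq_ell2)
  finally show ?thesis
    by simp
qed

lift_definition creation :: "'n \<Rightarrow> 'n fock \<Rightarrow>\<^sub>L 'n fock" is "\<lambda>i \<phi>. tensor_left i \<phi>"
proof (rule bounded_linear_intro[where K = 1])
  show "tensor_left i (\<phi> + \<psi>) = tensor_left i \<phi> + tensor_left i \<psi>" for i :: 'n and \<phi> \<psi>
    by transfer (auto split: list.splits)
  show "tensor_left i (r *\<^sub>R \<phi>) = r *\<^sub>R tensor_left i \<phi>" for i :: 'n and r \<phi>
    by transfer (auto split: list.splits)
qed (simp add: norm_tensor_left)

lemma complex_linear_creation: "complex_linear (creation i)"
  unfolding complex_linear_def by transfer (transfer, auto split: list.splits)

definition subalgebra :: "('a::complex_hilbert \<Rightarrow>\<^sub>L 'a) set \<Rightarrow> bool" where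
  "subalgebra \<A> \<longleftrightarrow>
    (\<forall>A\<in>\<A>. \<forall>B\<in>\<A>. A + B \<in> \<A> \<and> A o\<^sub>L B \<in> \<A>) \<and> (\<forall>c. \<forall>A\<in>\<A>. scalar_op c o\<^sub>L A \<in> \<A>)"

definition disc_algebra :: "('n::finite fock \<Rightarrow>\<^sub>L 'n fock) set" where
  "disc_algebra = (\<lambda>\<A>. subalgebra \<A> \<and> closed \<A>) hull insert id_blinfun (range creation)"

definition has_boundary_function ::
  "('n::finite list \<Rightarrow> complex) \<Rightarrow> ('n fock \<Rightarrow>\<^sub>L 'n fock) \<Rightarrow> bool" where
  "has_boundary_function a F \<longleftrightarrow>
    ((\<lambda>r. free_eval a (\<lambda>i. r *\<^sub>R creation i)) \<longlongrightarrow> F) (at_left (1::real))"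

end

theory Submission
  imports Defs "HOL-Complex_Analysis.Conformal_Mappings"
begin

text \<open>Write \<open>T\<^sub>\<alpha>\<^sup>*\<close> for the adjoint of \<open>T\<^sub>\<alpha>\<close> and choose \<open>r(T) < r < 1\<close>. Then
  \<open>Q h = \<Sum>\<^sub>\<gamma> r\<^bsup>-2|\<gamma>|\<^esup> \<parallel>T\<^sub>\<gamma>\<^sup>* h\<parallel>\<^sup>2\<close> is the square of an equivalent norm on \<open>\<H>\<close>, namely the norm of the vector
  \<open>v = (r\<^bsup>-|\<gamma>|\<^esup> T\<^sub>\<gamma>\<^sup>* h)\<^sub>\<gamma>\<close> of \<open>F\<^sup>2 \<otimes> \<H>\<close>, and \<open>h \<mapsto> v\<close> intertwines \<open>f\<^sub>j(T)\<^sup>*\<close> with \<open>f\<^sub>j(r S)\<^sup>* \<otimes> I\<close>. Contractivity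
  of \<open>f\<close> on nilpotent compressions of \<open>z S\<close>, combined with \<open>\<parallel>f(0)\<parallel> < 1\<close> and the scalar Schwarz--Pick
  inequality in \<open>z\<close>, bounds the row \<open>[f\<^sub>1(r S) \<dots> f\<^sub>m(r S)]\<close> by some \<open>\<rho> < 1\<close>. Hence
  \<open>\<Sum>\<^sub>j Q (f\<^sub>j(T)\<^sup>* h) \<le> \<rho>\<^sup>2 Q h\<close>, and iterating gives \<open>r(f(T)) \<le> \<rho>\<close>.\<close>

section \<open>Scalar estimates\<close>

text \<open>Fekete's lemma in multiplicative form: the limit is the infimum of the roots. Working
  with roots instead of logarithms allows \<open>b k = 0\<close>.\<close>

lemma submultiplicative_root_convergent:
  fixes b :: "nat \<Rightarrow> real"
  assumes nonneg: "\<And>k. 0 \<le> b k" and sub: "\<And>k l. b (k + l) \<le> b k * b l"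
  shows "convergent (\<lambda>k. root k (b k))"
proof -
  \<comment> \<open>Index 0 is left out because \<open>root 0\<close> is the zero function.\<close>
  define L where "L = (INF k\<in>{1..}. root k (b k))"
  have bdd: "bdd_below ((\<lambda>k. root k (b k)) ` {1..})"
    by (rule bdd_belowI2[where m = 0]) (simp add: nonneg)
  have lower: "L \<le> root k (b k)" if "1 \<le> k" for k
    unfolding L_def by (rule cINF_lower[OF bdd]) (use that in auto)
  have L0: "0 \<le> L"
    unfolding L_def by (rule cINF_greatest) (auto simp: nonneg)
  have power: "b (p * q + s) \<le> b p ^ q * b s" for p q s
  proof (induction q)
    case (Suc q)
    have "b (p * Suc q + s) \<le> b p * b (p * q + s)"
      using sub[of p "p * q + s"] by (simp add: algebra_simps)
    also have "\<dots> \<le> b p * (b p ^ q * b s)"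
      by (intro mult_left_mono Suc nonneg)
    finally show ?case
      by (simp add: mult.assoc)
  qed simp
  have "(\<lambda>k. root k (b k)) \<longlonglongrightarrow> L"
  proof (rule order_tendstoI)
    fix a assume "a < L"
    then show "\<forall>\<^sub>F k in sequentially. a < root k (b k)"
      using lower by (intro eventually_sequentiallyI[of 1]) (meson less_le_trans)
  next
    fix a assume "L < a"
    then obtain c where c: "L < c" "c < a"
      using dense by blast
    then have c0: "0 < c"
      using L0 by simp
    have "\<exists>p\<in>{1..}. root p (b p) < c"
      using c(1) unfolding L_def by (subst (asm) cINF_less_iff[OF _ bdd]) auto
    then obtain p where p: "1 \<le> p" "root p (b p) < c"
      by auto
    have bp: "b p \<le> c ^ p"
      using p nonneg[of p] power_mono[of "root p (b p)" c p] by (simp add: real_root_pow_pos2)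
    \<comment> \<open>With \<open>p\<close> nearly attaining the infimum, write
      \<open>n = p * (n div p) + n mod p\<close>. The constant \<open>M\<close> dominates
      \<open>b s / c ^ s\<close> for every possible remainder at once; its summand 1 makes it
      positive, so that \<open>root n M\<close> tends to 1.\<close>
    define M where "M = 1 + (\<Sum>s<p. b s / c ^ s)"
    have M0: "0 < M"
      unfolding M_def using c0 nonneg by (intro add_pos_nonneg sum_nonneg) auto
    have bM: "b s \<le> c ^ s * M" if "s < p" for s
    proof -
      have "b s / c ^ s \<le> (\<Sum>s<p. b s / c ^ s)"
        using that c0 nonneg by (intro member_le_sum) auto
      then have "b s / c ^ s \<le> M"
        by (simp add: M_def)
      then show ?thesis
        using c0 by (simp add: divide_le_eq mult.commute)
    qed
    have upper: "b n \<le> c ^ n * M" for n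
    proof -
      have "b n \<le> b p ^ (n div p) * b (n mod p)"
        using power[of p "n div p" "n mod p"] by simp
      also have "\<dots> \<le> (c ^ p) ^ (n div p) * (c ^ (n mod p) * M)"
        using p c0 by (intro mult_mono power_mono bp bM nonneg zero_le_power) auto
      also have "\<dots> = c ^ (p * (n div p) + n mod p) * M"
        by (simp only: power_add power_mult mult.assoc)
      finally show ?thesis
        by simp
    qed
    have "(\<lambda>n. c * root n M) \<longlonglongrightarrow> c * 1"
      by (intro tendsto_intros LIMSEQ_root_const M0)
    then have "\<forall>\<^sub>F n in sequentially. c * root n M < a"
      using c(2) by (intro order_tendstoD) auto
    then show "\<forall>\<^sub>F n in sequentially. root n (b n) < a"
      using eventually_ge_at_top[of 1]
    proof eventually_elim
      case (elim n)
      have "root n (b n) \<le> root n (c ^ n * M)"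
        using elim by (intro real_root_le_mono upper) auto
      also have "\<dots> = c * root n M"
        using elim c0 by (simp add: real_root_mult real_root_power_cancel)
      finally show ?case
        using elim by simp
    qed
  qed
  then show ?thesis
    by (auto simp: convergent_def)
qed

text \<open>The disc automorphism moving \<open>a = \<phi> 0\<close> to 0 reduces this to the
  Schwarz lemma. The identity \<open>ident\<close> and \<open>1 - |a| \<le> |1 - cnj a * w|\<close>
  then bound \<open>1 - |w|^2\<close> below by \<open>(1 - r^2) (1 - |a|) / (1 + |a|)\<close>, and
  \<open>1 + |a| \<le> 2\<close>. The resulting bound depends only on \<open>c\<close> and
  \<open>r\<close>, which later makes it uniform over all test vectors.\<close>

lemma Schwarz_Pick_bound_strict:
  assumes hol: "\<phi> holomorphic_on ball 0 1"
    and bound: "\<And>z. cmod z < 1 \<Longrightarrow> cmod (\<phi> z) < 1"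
    and zero: "cmod (\<phi> 0) \<le> c" and z: "cmod z \<le> r" "r < 1"
  shows "(cmod (\<phi> z))\<^sup>2 \<le> 1 - (1 - c) * (1 - r\<^sup>2) / 2"
proof -
  define a where "a = \<phi> 0"
  have a1: "cmod a < 1"
    using bound[of 0] by (simp add: a_def)
  have ident: "(cmod (1 - cnj a * w))\<^sup>2 - (cmod (w - a))\<^sup>2 = (1 - (cmod a)\<^sup>2) * (1 - (cmod w)\<^sup>2)" for w
    unfolding cmod_power2 by (simp add: power2_eq_square algebra_simps)
  have low: "1 - cmod a \<le> cmod (1 - cnj a * w)" if "cmod w < 1" for w
  proof -
    have "cmod a * cmod w \<le> cmod a * 1"
      using that by (intro mult_left_mono) auto
    then show ?thesis
      using norm_triangle_ineq2[of 1 "cnj a * w"] by (simp add: norm_mult)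
  qed
  have nz: "1 - cnj a * w \<noteq> 0" if "cmod w < 1" for w
    using low[OF that] a1 by auto
  define \<psi> where "\<psi> = (\<lambda>z. (\<phi> z - a) / (1 - cnj a * \<phi> z))"
  have "cmod (\<psi> z) \<le> cmod z"
  proof (rule Schwarz_Lemma(1))
    show "\<psi> holomorphic_on ball 0 1"
      unfolding \<psi>_def by (intro holomorphic_intros hol) (use bound nz in auto)
    show "\<psi> 0 = 0"
      by (simp add: \<psi>_def a_def)
    show "cmod (\<psi> x) < 1" if "cmod x < 1" for x
    proof -
      have "0 < (1 - (cmod a)\<^sup>2) * (1 - (cmod (\<phi> x))\<^sup>2)"
        using a1 bound[OF that] by (intro mult_pos_pos) (auto simp: abs_square_less_1)
      then have "(cmod (\<phi> x - a))\<^sup>2 < (cmod (1 - cnj a * \<phi> x))\<^sup>2"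
        using ident[of "\<phi> x"] by simp
      then have "cmod (\<phi> x - a) < cmod (1 - cnj a * \<phi> x)"
        by (rule power2_less_imp_less) simp
      then show ?thesis
        using nz[OF bound[OF that]] by (simp add: \<psi>_def norm_divide divide_less_eq)
    qed
    show "cmod z < 1"
      using z by simp
  qed
  then have \<psi>: "cmod (\<psi> z) \<le> r"
    using z by simp
  define w where "w = \<phi> z"
  have w1: "cmod w < 1"
    using bound z by (simp add: w_def)
  have r0: "0 \<le> r"
    using z(1) norm_ge_zero[of z] by linarith
  have r1: "0 \<le> 1 - r\<^sup>2"
    using r0 z by (simp add: abs_square_le_1)
  have "cmod (w - a) = cmod (\<psi> z) * cmod (1 - cnj a * w)"
    using nz[OF w1] by (simp add: \<psi>_def w_def norm_divide)
  also have "\<dots> \<le> r * cmod (1 - cnj a * w)"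
    by (intro mult_right_mono \<psi>) auto
  finally have "(cmod (w - a))\<^sup>2 \<le> r\<^sup>2 * (cmod (1 - cnj a * w))\<^sup>2"
    by (metis norm_ge_zero power_mono power_mult_distrib)
  then have "(1 - r\<^sup>2) * (cmod (1 - cnj a * w))\<^sup>2 \<le> (1 - (cmod a)\<^sup>2) * (1 - (cmod w)\<^sup>2)"
    using ident[of w] by (simp add: algebra_simps)
  moreover have "(1 - r\<^sup>2) * (1 - cmod a)\<^sup>2 \<le> (1 - r\<^sup>2) * (cmod (1 - cnj a * w))\<^sup>2"
    using a1 low[OF w1] r1 by (intro mult_left_mono power_mono) auto
  ultimately have "(1 - cmod a) * ((1 - r\<^sup>2) * (1 - cmod a)) \<le> (1 - cmod a) * ((1 + cmod a) * (1 - (cmod w)\<^sup>2))"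
    by (simp add: power2_eq_square algebra_simps)
  then have "(1 - r\<^sup>2) * (1 - cmod a) \<le> (1 + cmod a) * (1 - (cmod w)\<^sup>2)"
    using a1 by simp
  also have "\<dots> \<le> 2 * (1 - (cmod w)\<^sup>2)"
    using a1 w1 by (intro mult_right_mono) (auto simp: abs_square_le_1)
  finally have "(1 - r\<^sup>2) * (1 - cmod a) \<le> 2 * (1 - (cmod w)\<^sup>2)" .
  moreover have "(1 - r\<^sup>2) * (1 - c) \<le> (1 - r\<^sup>2) * (1 - cmod a)"
    using zero r1 by (intro mult_left_mono) (auto simp: a_def)
  ultimately have "(1 - r\<^sup>2) * (1 - c) \<le> 2 * (1 - (cmod w)\<^sup>2)"
    by linarith
  then show ?thesis
    by (simp add: w_def field_simps)
qed

lemma Schwarz_Pick_bound: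
  assumes hol: "\<phi> holomorphic_on ball 0 1"
    and bound: "\<And>z. cmod z < 1 \<Longrightarrow> cmod (\<phi> z) \<le> 1"
    and zero: "cmod (\<phi> 0) \<le> c" and z: "cmod z \<le> r" "r < 1"
  shows "(cmod (\<phi> z))\<^sup>2 \<le> 1 - (1 - c) * (1 - r\<^sup>2) / 2"
proof (rule tendsto_upperbound)
  show "((\<lambda>t. (cmod (complex_of_real t * \<phi> z))\<^sup>2) \<longlongrightarrow> (cmod (\<phi> z))\<^sup>2) (at_left 1)"
    by (auto intro!: tendsto_eq_intros)
  have "(cmod (complex_of_real t * \<phi> z))\<^sup>2 \<le> 1 - (1 - c) * (1 - r\<^sup>2) / 2" if t: "0 < t" "t < 1" for t
  proof (rule Schwarz_Pick_bound_strict[where \<phi> = "\<lambda>z. complex_of_real t * \<phi> z"])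
    show "(\<lambda>z. complex_of_real t * \<phi> z) holomorphic_on ball 0 1"
      by (intro holomorphic_intros hol)
    show "cmod (complex_of_real t * \<phi> x) < 1" if "cmod x < 1" for x
    proof -
      have "t * cmod (\<phi> x) \<le> t * 1"
        using t by (intro mult_left_mono bound that) auto
      also have "\<dots> < 1"
        using t by simp
      finally show ?thesis
        using t by (simp add: norm_mult)
    qed
    show "cmod (complex_of_real t * \<phi> 0) \<le> c"
      using t zero mult_left_le_one_le[of "cmod (\<phi> 0)" t] by (simp add: norm_mult)
  qed (use z in auto)
  then show "\<forall>\<^sub>F t in at_left 1. (cmod (complex_of_real t * \<phi> z))\<^sup>2 \<le> 1 - (1 - c) * (1 - r\<^sup>2) / 2"
    using eventually_at_left_real[of 0 1] by (auto elim: eventually_mono)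
qed simp


section \<open>Orthonormal families\<close>

lemma cinner_add_right: "cinner x (y + z) = cinner x y + cinner x z"
  by (metis cinner_commute cinner_add_left complex_cnj_add)

lemma cinner_scaleC_right: "cinner x (c *\<^sub>C y) = cnj c * cinner x y"
  by (metis cinner_commute cinner_scaleC_left complex_cnj_mult)

lemma cinner_zero_left [simp]: "cinner 0 y = 0"
  using cinner_add_left[of 0 0 y] by simp

lemma cinner_zero_right [simp]: "cinner x 0 = 0"
  using cinner_add_right[of x 0 0] by simp

lemma cinner_diff_left: "cinner (x - y) z = cinner x z - cinner y z"
  using cinner_add_left[of "x - y" y z] by simp

lemma cinner_diff_right: "cinner x (y - z) = cinner x y - cinner x z"
  using cinner_add_right[of x "y - z" z] by simp

lemma cinner_sum_left: "cinner (sum f A) y = (\<Sum>i\<in>A. cinner (f i) y)"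
  by (induction A rule: infinite_finite_induct) (auto simp: cinner_add_left)

lemma cinner_sum_right: "cinner x (sum f A) = (\<Sum>i\<in>A. cinner x (f i))"
  by (induction A rule: infinite_finite_induct) (auto simp: cinner_add_right)

lemma scaleC_zero_left [simp]: "0 *\<^sub>C x = (0 :: 'a::complex_hilbert)"
  using scaleC_of_real[of 0 x] by simp

lemma scaleC_one [simp]: "1 *\<^sub>C x = (x :: 'a::complex_hilbert)"
  using scaleC_of_real[of 1 x] by simp

lemma scaleC_zero_right [simp]: "c *\<^sub>C 0 = (0 :: 'a::complex_hilbert)"
  by (simp flip: norm_eq_zero add: norm_scaleC)

lemma scaleC_sum_right: "c *\<^sub>C sum f A = (\<Sum>i\<in>A. c *\<^sub>C (f i :: 'a::complex_hilbert))"
  by (induction A rule: infinite_finite_induct) (auto simp: scaleC_add_right)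

lemma scaleC_sum_left: "sum f A *\<^sub>C x = (\<Sum>i\<in>A. f i *\<^sub>C (x :: 'a::complex_hilbert))"
  by (induction A rule: infinite_finite_induct) (auto simp: scaleC_add_left)

lemma cinner_eqI:
  assumes "\<And>x. cinner x u = cinner x v"
  shows "u = v"
proof -
  have "cinner (u - v) (u - v) = 0"
    using assms[of "u - v"] by (simp add: cinner_diff_right)
  then show ?thesis
    by (simp add: cinner_self)
qed

lemma cinner_Cauchy_Schwarz: "cmod (cinner x y) \<le> norm x * norm y"
proof -
  \<comment> \<open>Multiplying \<open>x\<close> by \<open>w\<close> turns the inner product into
    its modulus and reduces the claim to the real Cauchy--Schwarz inequality. As
    \<open>sgn 0 = 0\<close>, only \<open>|w| \<le> 1\<close> is available, which suffices.\<close>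
  define w where "w = cnj (sgn (cinner x y))"
  have "cinner (w *\<^sub>C x) y = complex_of_real (cmod (cinner x y))"
    by (simp add: w_def cinner_scaleC_left sgn_eq mult.commute[of "cnj _"]
        flip: complex_norm_square) (simp add: power2_eq_square)
  then have "cmod (cinner x y) = inner (w *\<^sub>C x) y"
    by (simp add: inner_eq_Re_cinner)
  also have "\<dots> \<le> norm (w *\<^sub>C x) * norm y"
    by (rule norm_cauchy_schwarz)
  also have "\<dots> \<le> norm x * norm y"
    by (intro mult_right_mono) (auto simp: norm_scaleC w_def norm_sgn)
  finally show ?thesis .
qed

definition orthonormal :: "('i \<Rightarrow> 'a::complex_hilbert) \<Rightarrow> 'i set \<Rightarrow> bool" where
  "orthonormal e W \<longleftrightarrow> (\<forall>\<alpha>\<in>W. \<forall>\<beta>\<in>W. cinner (e \<alpha>) (e \<beta>) = (if \<alpha> = \<beta> then 1 else 0))"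

lemma orthonormalD:
  "orthonormal e W \<Longrightarrow> \<alpha> \<in> W \<Longrightarrow> \<beta> \<in> W \<Longrightarrow> cinner (e \<alpha>) (e \<beta>) = (if \<alpha> = \<beta> then 1 else 0)"
  by (simp add: orthonormal_def)

lemma orthonormal_subset: "orthonormal e W \<Longrightarrow> V \<subseteq> W \<Longrightarrow> orthonormal e V"
  unfolding orthonormal_def by blast

lemma cinner_orthonormal_sum:
  assumes "orthonormal e W" "finite W" "\<beta> \<in> W"
  shows "cinner (\<Sum>\<alpha>\<in>W. c \<alpha> *\<^sub>C e \<alpha>) (e \<beta>) = c \<beta>"
  using assms by (simp add: cinner_sum_left cinner_scaleC_left orthonormalD if_distrib cong: if_cong)

lemma norm_orthonormal_sum:
  assumes "orthonormal e W" "finite W"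
  shows "(norm (\<Sum>\<alpha>\<in>W. c \<alpha> *\<^sub>C e \<alpha>))\<^sup>2 = (\<Sum>\<alpha>\<in>W. (cmod (c \<alpha>))\<^sup>2)"
proof -
  have "complex_of_real ((norm (\<Sum>\<alpha>\<in>W. c \<alpha> *\<^sub>C e \<alpha>))\<^sup>2)
      = (\<Sum>\<beta>\<in>W. cnj (c \<beta>) * c \<beta>)"
    unfolding cinner_self[symmetric]
    by (subst cinner_sum_right) (simp add: cinner_scaleC_right cinner_orthonormal_sum[OF assms])
  also have "\<dots> = complex_of_real (\<Sum>\<alpha>\<in>W. (cmod (c \<alpha>))\<^sup>2)"
    unfolding of_real_sum complex_norm_square by (simp add: mult.commute)
  finally show ?thesis
    using of_real_eq_iff by blast
qed

text \<open>Pythagoras for the projection \<open>y\<close> of \<open>x\<close> onto the span of the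
  family and the remainder \<open>x - y\<close>.\<close>

lemma Bessel_inequality:
  assumes "orthonormal e W" "finite W"
  shows "(\<Sum>\<alpha>\<in>W. (cmod (cinner x (e \<alpha>)))\<^sup>2) \<le> (norm x)\<^sup>2"
proof -
  define y where "y = (\<Sum>\<alpha>\<in>W. cinner x (e \<alpha>) *\<^sub>C e \<alpha>)"
  have "cinner y (x - y) = 0"
  proof -
    have "cinner (x - y) (e \<alpha>) = 0" if "\<alpha> \<in> W" for \<alpha>
      using that by (simp add: cinner_diff_left y_def cinner_orthonormal_sum[OF assms])
    then have "cinner (x - y) y = 0"
      by (subst (2) y_def) (simp add: cinner_sum_right cinner_scaleC_right)
    then show ?thesis
      by (metis cinner_commute complex_cnj_zero)
  qed
  then have "inner y (x - y) = 0"
    by (simp add: inner_eq_Re_cinner)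
  then have "(norm (y + (x - y)))\<^sup>2 = (norm y)\<^sup>2 + (norm (x - y))\<^sup>2"
    by (simp only: power2_norm_eq_inner inner_add inner_commute)
  then have "(norm y)\<^sup>2 \<le> (norm x)\<^sup>2"
    by simp
  then show ?thesis
    by (simp add: y_def norm_orthonormal_sum[OF assms])
qed

section \<open>Gram--Schmidt orthogonalisation\<close>

lemma orthonormal_expansion_mono:
  assumes "orthonormal (\<lambda>u. u) U'" "U \<subseteq> U'" "finite U'" and x: "x = (\<Sum>u\<in>U. cinner x u *\<^sub>C u)"
  shows "x = (\<Sum>u\<in>U'. cinner x u *\<^sub>C u)"
proof -
  \<comment> \<open>A vector in the span of \<open>U\<close> has zero coefficient at every new
    member of \<open>U'\<close>, so earlier expansions survive an extension of the system.\<close>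
  have "cinner x w = 0" if w: "w \<in> U' - U" for w
  proof -
    have "cinner x w = (\<Sum>u\<in>U. cinner x u * cinner u w)"
      by (subst x) (simp add: cinner_sum_left cinner_scaleC_left)
    also have "\<dots> = 0"
    proof (intro sum.neutral ballI)
      fix u assume "u \<in> U"
      then show "cinner x u * cinner u w = 0"
        using w subsetD[OF assms(2)] orthonormalD[OF assms(1), of u w] by (auto split: if_splits)
    qed
    finally show ?thesis .
  qed
  then have "(\<Sum>u\<in>U. cinner x u *\<^sub>C u) = (\<Sum>u\<in>U'. cinner x u *\<^sub>C u)"
    using assms by (intro sum.mono_neutral_left) auto
  with x show ?thesis
    by simp
qed

text \<open>One Gram--Schmidt step: the remainder of \<open>v\<close> after projection is normalised
  and adjoined, unless it vanishes.\<close>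

lemma orthonormal_extend:
  assumes U: "orthonormal (\<lambda>u. u) U" "finite U"
  shows "\<exists>U'. finite U' \<and> U \<subseteq> U' \<and> orthonormal (\<lambda>u. u) U' \<and> v = (\<Sum>u\<in>U'. cinner v u *\<^sub>C u)"
proof -
  define p where "p = (\<Sum>u\<in>U. cinner v u *\<^sub>C u)"
  define w where "w = v - p"
  have wU: "cinner w u = 0" "cinner u w = 0" if "u \<in> U" for u
  proof -
    show "cinner w u = 0"
      using that by (simp add: w_def p_def cinner_diff_left cinner_orthonormal_sum[OF U])
    then show "cinner u w = 0"
      by (metis cinner_commute complex_cnj_zero)
  qed
  show ?thesis
  proof (cases "w = 0")
    case True
    then have "v = (\<Sum>u\<in>U. cinner v u *\<^sub>C u)"
      by (simp add: w_def p_def)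
    with U show ?thesis
      by blast
  next
    case False
    define t where "t = complex_of_real (inverse (norm w))"
    define e where "e = t *\<^sub>C w"
    have ee: "cinner e e = 1"
      unfolding cinner_self using False by (simp add: e_def t_def norm_scaleC norm_inverse)
    have eU: "cinner e u = 0" "cinner u e = 0" if "u \<in> U" for u
      using wU[OF that] by (simp_all add: e_def cinner_scaleC_left cinner_scaleC_right)
    have e_notin: "e \<notin> U"
      using eU ee by force
    have on: "orthonormal (\<lambda>u. u) (insert e U)"
      using U(1) ee eU by (auto simp: orthonormal_def)
    have pe: "cinner p e = 0"
      by (simp add: p_def cinner_sum_left cinner_scaleC_left eU)
    have we: "w = complex_of_real (norm w) *\<^sub>C e"
      using False by (simp add: e_def t_def scaleC_scaleC flip: of_real_mult)
    have "cinner v e = cinner w e"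
      using pe by (simp add: w_def cinner_diff_left)
    also have "\<dots> = complex_of_real (norm w)"
      by (subst we) (simp add: cinner_scaleC_left ee)
    finally have "v = (\<Sum>u\<in>insert e U. cinner v u *\<^sub>C u)"
      using U(2) e_notin we by (simp add: w_def p_def algebra_simps)
    with U on show ?thesis
      by (intro exI[of _ "insert e U"]) auto
  qed
qed

lemma finite_orthonormal_basis:
  assumes "finite B"
  shows "\<exists>U. finite U \<and> orthonormal (\<lambda>u. u) U \<and> (\<forall>v\<in>B. v = (\<Sum>u\<in>U. cinner v u *\<^sub>C u))"
  using assms
proof induction
  case empty
  show ?case
    by (intro exI[of _ "{}"]) (simp add: orthonormal_def)
next
  case (insert x B)
  then obtain U where U: "finite U" "orthonormal (\<lambda>u. u) U" "\<forall>v\<in>B. v = (\<Sum>u\<in>U. cinner v u *\<^sub>C u)"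
    by blast
  obtain U' where U': "finite U'" "U \<subseteq> U'" "orthonormal (\<lambda>u. u) U'" "x = (\<Sum>u\<in>U'. cinner x u *\<^sub>C u)"
    using orthonormal_extend[OF U(2,1)] by blast
  then show ?case
    using U(3) orthonormal_expansion_mono[OF U'(3,2,1)] by blast
qed

lemma infinite_dimensional_orthonormal:
  assumes inf: "infinite_dimensional TYPE('k::complex_hilbert)"
  shows "\<exists>U::'k set. finite U \<and> card U = n \<and> orthonormal (\<lambda>u. u) U"
proof (induction n)
  case 0
  show ?case
    by (intro exI[of _ "{}"]) (simp add: orthonormal_def)
next
  case (Suc n)
  interpret vector_space "(*\<^sub>C) :: complex \<Rightarrow> 'k \<Rightarrow> 'k"
    by (rule vector_space_scaleC)
  obtain U :: "'k set" where U: "finite U" "card U = n" "orthonormal (\<lambda>u. u) U"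
    using Suc by blast
  then obtain v where v: "v \<notin> span U"
    using inf unfolding infinite_dimensional_def by blast
  obtain U' where U': "finite U'" "U \<subseteq> U'" "orthonormal (\<lambda>u. u) U'" "v = (\<Sum>u\<in>U'. cinner v u *\<^sub>C u)"
    using orthonormal_extend[OF U(3,1)] by blast
  have "(\<Sum>u\<in>U. cinner v u *\<^sub>C u) \<in> span U"
    by (intro span_sum span_scale span_base)
  \<comment> \<open>Equality would put \<open>v\<close> into the span of \<open>U\<close>. The
    extension lemma does not count the new vectors, so a subset of the right size is cut out
    afterwards.\<close>
  then have "U \<noteq> U'"
    using U'(4) v by metis
  then have "Suc n \<le> card U'"
    using U U' psubset_card_mono[of U' U] by (auto simp: psubset_eq)
  then obtain V where "V \<subseteq> U'" "card V = Suc n" "finite V"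
    by (rule obtain_subset_with_card_n)
  then show ?case
    using U'(3) orthonormal_subset by blast
qed

text \<open>For \<open>W\<close> a finite set of words, this places a truncated Fock space inside
  any infinite-dimensional space.\<close>

lemma orthonormal_family_exists:
  assumes "infinite_dimensional TYPE('k::complex_hilbert)" "finite W"
  shows "\<exists>e :: 'i \<Rightarrow> 'k. orthonormal e W"
proof -
  obtain U :: "'k set" where U: "finite U" "card U = card W" "orthonormal (\<lambda>u. u) U"
    using infinite_dimensional_orthonormal[OF assms(1)] by blast
  then obtain e where "bij_betw e W U"
    using finite_same_card_bij[OF assms(2) U(1)] by auto
  then have "orthonormal e W"
    using U(3) by (auto simp: orthonormal_def bij_betw_def inj_on_def)
  then show ?thesis
    by blast
qed


section \<open>Adjoints and row operators\<close>

text \<open>The representing vector minimises \<open>J x = |x|^2 - 2 \<phi> x\<close>. The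
  functional is bounded below, minimising sequences are Cauchy by the parallelogram identity, and
  the first variation at the minimiser vanishes.\<close>

lemma Riesz_representation:
  fixes \<phi> :: "'a::{real_inner,complete_space} \<Rightarrow> real"
  assumes "bounded_linear \<phi>"
  shows "\<exists>y. \<forall>x. \<phi> x = inner x y"
proof -
  interpret bounded_linear \<phi> by fact
  obtain K where K: "\<And>x. norm (\<phi> x) \<le> norm x * K"
    using bounded by blast
  define J where "J x = (norm x)\<^sup>2 - 2 * \<phi> x" for x
  have low: "- (K\<^sup>2) \<le> J x" for x
  proof -
    have "2 * \<phi> x \<le> 2 * (norm x * K)"
      using K[of x] by simp
    then show ?thesis
      using sum_squares_bound[of "norm x" K] by (simp add: J_def)
  qed
  define d where "d = (INF x. J x)"
  have bdd: "bdd_below (range J)"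
    using low by (intro bdd_belowI2)
  have dJ: "d \<le> J x" for x
    unfolding d_def by (rule cINF_lower[OF bdd]) simp
  have "\<exists>x. J x < d + inverse (real (Suc n))" for n
    using cINF_less_iff[OF _ bdd, of "d + inverse (real (Suc n))"] by (simp add: d_def)
  then obtain X where X: "\<And>n. J (X n) < d + inverse (real (Suc n))"
    by metis
  have parallelogram: "J x + J y - 2 * J ((1/2) *\<^sub>R (x + y)) = (norm (x - y))\<^sup>2 / 2" for x y
    by (simp add: J_def add scaleR power2_norm_eq_inner inner_diff inner_add inner_commute field_simps)
  have "Cauchy X"
  proof (rule CauchyI)
    fix e :: real assume e: "0 < e"
    \<comment> \<open>The parallelogram identity gives \<open>|X m - X n|^2 / 2\<close> below twice
      the tolerance, hence the quarter of \<open>e^2\<close>.\<close>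
    then obtain N where N: "inverse (real (Suc N)) < e\<^sup>2 / 4"
      using reals_Archimedean[of "e\<^sup>2 / 4"] by auto
    have "norm (X m - X n) < e" if "N \<le> m" "N \<le> n" for m n
    proof -
      have "inverse (real (Suc m)) \<le> inverse (real (Suc N))" "inverse (real (Suc n)) \<le> inverse (real (Suc N))"
        using that by (auto intro!: le_imp_inverse_le)
      then have "(norm (X m - X n))\<^sup>2 < e\<^sup>2"
        using X[of m] X[of n] N dJ[of "(1/2) *\<^sub>R (X m + X n)"] parallelogram[of "X m" "X n"] by linarith
      then show ?thesis
        using e by (simp add: power2_less_imp_less)
    qed
    then show "\<exists>M. \<forall>m\<ge>M. \<forall>n\<ge>M. norm (X m - X n) < e"
      by blast
  qed
  then obtain y where y: "X \<longlonglongrightarrow> y"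
    by (metis Cauchy_convergent_iff convergent_def)
  have "(\<lambda>n. J (X n)) \<longlonglongrightarrow> J y"
    unfolding J_def by (intro tendsto_intros y tendsto)
  moreover have "(\<lambda>n. d + inverse (real (Suc n))) \<longlonglongrightarrow> d + 0"
    by (intro tendsto_intros LIMSEQ_inverse_real_of_nat)
  ultimately have "J y \<le> d + 0"
    using X by (intro LIMSEQ_le) (auto intro: less_imp_le)
  then have min: "J y \<le> J x" for x
    using dJ[of x] by simp
  have "\<phi> v = inner v y" for v
  proof -
    define s where "s = inner v y - \<phi> v"
    define N where "N = (norm v)\<^sup>2"
    have N: "0 \<le> N"
      by (simp add: N_def)
    have t: "0 \<le> 2 * t * s + t\<^sup>2 * N" for t
      using min[of "y + t *\<^sub>R v"] unfolding J_def s_def N_def power2_norm_eq_inner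
      by (simp add: add scaleR inner_add inner_commute power2_eq_square algebra_simps)
    \<comment> \<open>Inserting \<open>t = - u\<close> into the nonnegative quadratic leaves
      \<open>- u^2 (N + 2) \<ge> 0\<close>; the \<open>+ 1\<close> avoids division by zero when
      \<open>v = 0\<close>.\<close>
    define u where "u = s / (N + 1)"
    have s: "s = u * (N + 1)"
      using N by (simp add: u_def)
    have "u\<^sup>2 * (N + 2) \<le> 0"
      using t[of "- u"] by (simp add: s power2_eq_square algebra_simps)
    then have "u = 0"
      using N by (simp add: mult_le_0_iff)
    then have "s = 0"
      by (simp add: s)
    then show ?thesis
      by (simp add: s_def)
  qed
  then show ?thesis
    by blast
qed

section \<open>Existence and uniqueness of the adjoint\<close>

lemma adj_eqI:
  assumes "\<And>x y. cinner (blinfun_apply A x) y = cinner x (blinfun_apply B y)"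
  shows "adj A = B"
  unfolding adj_def
proof (rule the_equality)
  show "\<forall>x y. cinner (blinfun_apply A x) y = cinner x (blinfun_apply B y)"
    using assms by blast
next
  fix B' assume "\<forall>x y. cinner (blinfun_apply A x) y = cinner x (blinfun_apply B' y)"
  then have "cinner x (blinfun_apply B' y) = cinner x (blinfun_apply B y)" for x y
    using assms by metis
  then show "B' = B"
    by (intro blinfun_eqI) (auto intro: cinner_eqI)
qed

lemma Im_cinner: "Im (cinner x y) = inner (- \<i> *\<^sub>C x) y"
  by (simp add: inner_eq_Re_cinner cinner_scaleC_left)

text \<open>The imaginary part of the inner product is its real part after multiplying the first
  argument by \<open>- \<i>\<close>, so complex linearity of \<open>A\<close> upgrades adjointness
  from the real to the complex inner product.\<close>

lemma cinner_eq_if_inner_eq: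
  assumes "complex_linear A" and "\<And>x. inner (blinfun_apply A x) y = inner x z"
  shows "cinner (blinfun_apply A x) y = cinner x z"
proof (rule complex_eqI)
  show "Re (cinner (blinfun_apply A x) y) = Re (cinner x z)"
    using assms(2) by (simp flip: inner_eq_Re_cinner)
  show "Im (cinner (blinfun_apply A x) y) = Im (cinner x z)"
    unfolding Im_cinner using assms by (metis complex_linear_def)
qed

text \<open>Justifies the definite description in \<open>adj\<close>: Riesz representation gives a
  candidate \<open>g\<close>, which is linear and bounded by \<open>norm A\<close>.\<close>

lemma cinner_adj:
  assumes "complex_linear A"
  shows "cinner (blinfun_apply A x) y = cinner x (blinfun_apply (adj A) y)"
proof -
  have "\<exists>z. \<forall>x. inner (blinfun_apply A x) y = inner x z" for y
    by (rule Riesz_representation)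
      (intro bounded_linear_compose[OF bounded_linear_inner_left blinfun.bounded_linear_right])
  then obtain g where g: "\<And>x y. inner (blinfun_apply A x) y = inner x (g y)"
    by metis
  have "bounded_linear g"
  proof (rule bounded_linear_intro[where K = "norm A"])
    show "g (y + z) = g y + g z" for y z
      by (subst vector_eq_ldot[symmetric]) (simp add: inner_add_right flip: g)
    show "g (r *\<^sub>R y) = r *\<^sub>R g y" for r y
      by (subst vector_eq_ldot[symmetric]) (simp flip: g)
    show "norm (g y) \<le> norm y * norm A" for y
    proof (cases "g y = 0")
      case False
      have "norm (g y) * norm (g y) = inner (blinfun_apply A (g y)) y"
        by (simp add: g flip: power2_norm_eq_inner power2_eq_square)
      also have "\<dots> \<le> norm (blinfun_apply A (g y)) * norm y"
        by (rule norm_cauchy_schwarz)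
      also have "\<dots> \<le> norm A * norm (g y) * norm y"
        by (intro mult_right_mono norm_blinfun) auto
      finally show ?thesis
        using False by (simp add: mult_ac)
    qed simp
  qed
  then have G: "blinfun_apply (Blinfun g) = g"
    by (rule bounded_linear_Blinfun_apply)
  have eq: "cinner (blinfun_apply A x) y = cinner x (blinfun_apply (Blinfun g) y)" for x y
    by (rule cinner_eq_if_inner_eq[OF assms]) (simp add: g G)
  then have "adj A = Blinfun g"
    by (rule adj_eqI)
  with eq show ?thesis
    by simp
qed

lemma norm_adj_le:
  assumes "complex_linear A"
  shows "norm (adj A) \<le> norm A"
proof (rule norm_blinfun_bound)
  fix y
  let ?B = "blinfun_apply (adj A)"
  show "norm (?B y) \<le> norm A * norm y"
  proof (cases "?B y = 0")
    case False
    have "complex_of_real (norm (?B y) * norm (?B y)) = cinner (blinfun_apply A (?B y)) y"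
      by (simp add: cinner_adj[OF assms] cinner_self power2_eq_square)
    then have "norm (?B y) * norm (?B y) = cmod (cinner (blinfun_apply A (?B y)) y)"
      by (metis abs_of_nonneg norm_ge_zero norm_of_real zero_le_mult_iff)
    also have "\<dots> \<le> norm (blinfun_apply A (?B y)) * norm y"
      by (rule cinner_Cauchy_Schwarz)
    also have "\<dots> \<le> norm A * norm (?B y) * norm y"
      by (intro mult_right_mono norm_blinfun) auto
    finally show ?thesis
      using False by (simp add: mult_ac)
  qed simp
qed simp

section \<open>Closure of complex linear operators and calculus of adjoints\<close>

lemma complex_linear_id [simp]: "complex_linear id_blinfun"
  by (simp add: complex_linear_def)

lemma complex_linear_zero [simp]: "complex_linear 0"
  by (simp add: complex_linear_def)

lemma complex_linear_compose:
  "complex_linear A \<Longrightarrow> complex_linear B \<Longrightarrow> complex_linear (A o\<^sub>L B)"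
  by (simp add: complex_linear_def)

lemma complex_linear_add: "complex_linear A \<Longrightarrow> complex_linear B \<Longrightarrow> complex_linear (A + B)"
  by (simp add: complex_linear_def blinfun.add_left scaleC_add_right)

lemma complex_linear_sum: "(\<And>i. i \<in> I \<Longrightarrow> complex_linear (A i)) \<Longrightarrow> complex_linear (sum A I)"
  by (induction I rule: infinite_finite_induct) (auto simp: complex_linear_add)

lemma complex_linear_scalar_op: "complex_linear (scalar_op c)"
  by (simp add: complex_linear_def scalar_op.rep_eq scaleC_scaleC mult.commute)

lemma complex_linear_op_word: "(\<And>i. complex_linear (T i)) \<Longrightarrow> complex_linear (op_word T \<alpha>)"
  by (induction \<alpha>) (auto intro: complex_linear_compose)

lemma complex_linear_diff: "complex_linear A \<Longrightarrow> complex_linear B \<Longrightarrow> complex_linear (A - B)"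
  by (simp add: complex_linear_def blinfun.diff_left bounded_linear.linear[OF bounded_linear_scaleC, THEN linear_diff])

lemma complex_linear_lim:
  assumes "\<And>n. complex_linear (A n)" "A \<longlonglongrightarrow> B"
  shows "complex_linear B"
  unfolding complex_linear_def
proof (intro allI)
  fix c x
  have "(\<lambda>n. blinfun_apply (A n) (c *\<^sub>C x)) \<longlonglongrightarrow> blinfun_apply B (c *\<^sub>C x)"
    by (intro tendsto_intros assms)
  moreover have "(\<lambda>n. c *\<^sub>C blinfun_apply (A n) x) \<longlonglongrightarrow> c *\<^sub>C blinfun_apply B x"
    by (intro bounded_linear.tendsto[OF bounded_linear_scaleC] tendsto_intros assms)
  moreover have "blinfun_apply (A n) (c *\<^sub>C x) = c *\<^sub>C blinfun_apply (A n) x" for n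
    using assms(1) by (simp add: complex_linear_def)
  ultimately show "blinfun_apply B (c *\<^sub>C x) = c *\<^sub>C blinfun_apply B x"
    by (simp add: LIMSEQ_unique)
qed

lemma adj_id [simp]: "adj id_blinfun = id_blinfun"
  by (rule adj_eqI) simp

lemma adj_compose:
  "complex_linear A \<Longrightarrow> complex_linear B \<Longrightarrow> adj (A o\<^sub>L B) = adj B o\<^sub>L adj A"
  by (rule adj_eqI) (simp add: cinner_adj)

lemma adj_diff: "complex_linear A \<Longrightarrow> complex_linear B \<Longrightarrow> adj (A - B) = adj A - adj B"
  by (rule adj_eqI) (simp add: cinner_adj blinfun.diff_left cinner_diff_left cinner_diff_right)

lemma adj_sum:
  assumes "\<And>i. i \<in> I \<Longrightarrow> complex_linear (A i)"
  shows "adj (sum A I) = (\<Sum>i\<in>I. adj (A i))"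
  by (rule adj_eqI)
    (use assms in \<open>simp add: cinner_adj blinfun.sum_left cinner_sum_left cinner_sum_right\<close>)

lemma adj_scalar_op: "adj (scalar_op c) = scalar_op (cnj c)"
  by (rule adj_eqI) (simp add: scalar_op.rep_eq cinner_scaleC_left cinner_scaleC_right)

lemma adj_lim:
  assumes "\<And>n. complex_linear (A n)" "A \<longlonglongrightarrow> B"
  shows "(\<lambda>n. adj (A n)) \<longlonglongrightarrow> adj B"
proof (rule LIM_zero_cancel, rule Lim_null_comparison)
  have B: "complex_linear B"
    using complex_linear_lim assms by blast
  show "\<forall>\<^sub>F n in sequentially. norm (adj (A n) - adj B) \<le> norm (A n - B)"
    using norm_adj_le[OF complex_linear_diff[OF assms(1) B]] by (simp add: adj_diff assms(1) B)
  show "(\<lambda>n. norm (A n - B)) \<longlonglongrightarrow> 0"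
    using assms(2) by (intro tendsto_norm_zero LIM_zero)
qed

lemma op_word_append: "op_word T (\<alpha> @ \<beta>) = op_word T \<alpha> o\<^sub>L op_word T \<beta>"
  by (induction \<alpha>) (auto intro: blinfun_eqI)

text \<open>The square of the norm of a row operator \<open>[A\<^sub>i]\<close> is the norm of \<open>\<Sum> A\<^sub>i A\<^sub>i\<^sup>*\<close>; the two halves of
  this identity, in terms of the column of adjoints.\<close>

lemma sum_norm_adj_le:
  assumes "\<And>i. i \<in> I \<Longrightarrow> complex_linear (A i)"
  shows "(\<Sum>i\<in>I. (norm (blinfun_apply (adj (A i)) h))\<^sup>2) \<le> norm (\<Sum>i\<in>I. A i o\<^sub>L adj (A i)) * (norm h)\<^sup>2"
proof -
  let ?S = "\<Sum>i\<in>I. A i o\<^sub>L adj (A i)"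
  have "(\<Sum>i\<in>I. (norm (blinfun_apply (adj (A i)) h))\<^sup>2) = inner (blinfun_apply ?S h) h"
    unfolding blinfun.sum_left inner_sum_left
    using assms by (intro sum.cong) (auto simp: inner_eq_Re_cinner cinner_adj cinner_self)
  also have "\<dots> \<le> norm (blinfun_apply ?S h) * norm h"
    by (rule norm_cauchy_schwarz)
  also have "\<dots> \<le> norm ?S * norm h * norm h"
    by (intro mult_right_mono norm_blinfun) auto
  finally show ?thesis
    by (simp add: power2_eq_square mult.assoc)
qed

lemma norm_sum_adj_le:
  assumes "\<And>i. i \<in> I \<Longrightarrow> complex_linear (A i)" and "0 \<le> c"
    and bound: "\<And>h. (\<Sum>i\<in>I. (norm (blinfun_apply (adj (A i)) h))\<^sup>2) \<le> c * (norm h)\<^sup>2"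
  shows "norm (\<Sum>i\<in>I. A i o\<^sub>L adj (A i)) \<le> c"
proof (rule norm_blinfun_bound)
  let ?S = "\<Sum>i\<in>I. A i o\<^sub>L adj (A i)"
  fix h
  \<comment> \<open>Pairing \<open>?S h\<close> with itself lets the hypothesis be applied at
    \<open>h\<close> and at \<open>k\<close>, each contributing a factor
    \<open>sqrt c\<close>.\<close>
  define k where "k = blinfun_apply ?S h"
  have "(norm k)\<^sup>2 = inner k k"
    by (simp add: power2_norm_eq_inner)
  also have "\<dots> = (\<Sum>i\<in>I. inner (blinfun_apply (adj (A i)) h) (blinfun_apply (adj (A i)) k))"
    by (subst (1) k_def, unfold blinfun.sum_left inner_sum_left)
      (use assms(1) in \<open>auto intro!: sum.cong simp: inner_eq_Re_cinner cinner_adj\<close>)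
  also have "\<dots> \<le> (\<Sum>i\<in>I. \<bar>norm (blinfun_apply (adj (A i)) h)\<bar> * \<bar>norm (blinfun_apply (adj (A i)) k)\<bar>)"
    by (intro sum_mono) (simp add: norm_cauchy_schwarz)
  also have "\<dots> \<le> L2_set (\<lambda>i. norm (blinfun_apply (adj (A i)) h)) I * L2_set (\<lambda>i. norm (blinfun_apply (adj (A i)) k)) I"
    by (rule L2_set_mult_ineq)
  also have "\<dots> \<le> (sqrt c * norm h) * (sqrt c * norm k)"
    unfolding L2_set_def using assms(2)
    by (intro mult_mono order_trans[OF real_sqrt_le_mono[OF bound]])
      (auto simp: real_sqrt_mult intro!: sum_nonneg)
  also have "\<dots> = c * norm h * norm k"
    using assms(2) by simp
  finally have "norm k * norm k \<le> c * norm h * norm k"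
    by (simp add: power2_eq_square)
  then show "norm k \<le> c * norm h"
    using assms(2) by (cases "k = 0") auto
qed (use assms in simp)


section \<open>Truncated Toeplitz operators\<close>

lemma finite_words_eq [simp]: "finite {\<alpha> :: 'n::finite list. length \<alpha> = k}"
  using finite_lists_length_eq[of "UNIV :: 'n set" k] by simp

lemma finite_words_le [simp]: "finite {\<alpha> :: 'n::finite list. length \<alpha> \<le> k}"
  using finite_lists_length_le[of "UNIV :: 'n set" k] by simp

lemma finite_words_less [simp]: "finite {\<alpha> :: 'n::finite list. length \<alpha> < k}"
  by (rule finite_subset[OF _ finite_words_le[of k]]) auto

lemma finite_words_add_le [simp]: "finite {\<alpha> :: 'n::finite list. length \<alpha> + l \<le> k}"
  by (rule finite_subset[OF _ finite_words_le[of k]]) auto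

lemma sum_words_le:
  "(\<Sum>\<alpha> :: 'n::finite list | length \<alpha> \<le> P. F \<alpha>) = (\<Sum>k\<le>P. \<Sum>\<alpha> | length \<alpha> = k. F \<alpha>)"
proof -
  have "(\<Sum>\<alpha> | length \<alpha> \<le> P. F \<alpha>) = (\<Sum>k\<le>P. \<Sum>\<alpha>\<in>{\<alpha>\<in>{\<alpha>. length \<alpha> \<le> P}. length \<alpha> = k}. F \<alpha>)"
    by (rule sum.group[symmetric]) auto
  also have "\<dots> = (\<Sum>k\<le>P. \<Sum>\<alpha> | length \<alpha> = k. F \<alpha>)"
    by (intro sum.cong) auto
  finally show ?thesis .
qed

section \<open>Finite rank compressions of the creation operators\<close>

lift_definition rank_one :: "'a::complex_hilbert \<Rightarrow> 'b::complex_hilbert \<Rightarrow> 'b \<Rightarrow>\<^sub>L 'a"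
  is "\<lambda>u v x. cinner x v *\<^sub>C u"
proof (rule bounded_linear_intro)
  fix u :: 'a and v x :: 'b and r :: real
  show "cinner (r *\<^sub>R x) v *\<^sub>C u = r *\<^sub>R (cinner x v *\<^sub>C u)"
    by (simp add: cinner_scaleC_left scaleC_scaleC flip: scaleC_of_real)
  have "cmod (cinner x v) * norm u \<le> norm x * norm v * norm u"
    by (intro mult_right_mono cinner_Cauchy_Schwarz) simp
  then show "norm (cinner x v *\<^sub>C u) \<le> norm x * (norm v * norm u)"
    by (simp add: norm_scaleC mult.assoc)
qed (simp add: cinner_add_left scaleC_add_left)

lemma complex_linear_rank_one: "complex_linear (rank_one u v)"
  by (simp add: complex_linear_def rank_one.rep_eq cinner_scaleC_left scaleC_scaleC)

lemma adj_rank_one: "adj (rank_one u v) = rank_one v u"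
  by (rule adj_eqI)
    (simp add: rank_one.rep_eq cinner_scaleC_left cinner_scaleC_right cinner_commute[of _ u])

text \<open>The operator \<open>z S\<^sub>i\<close>, compressed to the span of the words of length at most \<open>P\<close>. Being of
  finite rank and jointly nilpotent, these operators live on every infinite-dimensional space, and
  evaluating a free holomorphic function at them involves no limit.\<close>

definition trunc_shift :: "('n::finite list \<Rightarrow> 'k::complex_hilbert) \<Rightarrow> nat \<Rightarrow> complex \<Rightarrow> 'n \<Rightarrow> 'k \<Rightarrow>\<^sub>L 'k"
  where "trunc_shift e P z i = (\<Sum>\<alpha> | length \<alpha> < P. rank_one (z *\<^sub>C e (i # \<alpha>)) (e \<alpha>))"

lemma complex_linear_trunc_shift: "complex_linear (trunc_shift e P z i)"
  unfolding trunc_shift_def by (intro complex_linear_sum complex_linear_rank_one)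

context
  fixes e :: "'n::finite list \<Rightarrow> 'k::complex_hilbert" and P :: nat
  assumes e: "orthonormal e {\<alpha>. length \<alpha> \<le> P}"
begin

lemma trunc_shift_basis:
  assumes "length \<gamma> \<le> P"
  shows "blinfun_apply (trunc_shift e P z i) (e \<gamma>) = (if length \<gamma> < P then z *\<^sub>C e (i # \<gamma>) else 0)"
proof -
  have "blinfun_apply (trunc_shift e P z i) (e \<gamma>)
      = (\<Sum>\<alpha> | length \<alpha> < P. (if \<gamma> = \<alpha> then z *\<^sub>C e (i # \<alpha>) else 0))"
    unfolding trunc_shift_def blinfun.sum_left rank_one.rep_eq
    using assms by (intro sum.cong) (auto simp: orthonormalD[OF e])
  then show ?thesis
    by simp
qed

lemma op_word_trunc_shift_basis:
  assumes "length \<beta> \<le> P"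
  shows "blinfun_apply (op_word (trunc_shift e P z) \<alpha>) (e \<beta>)
    = (if length \<alpha> + length \<beta> \<le> P then z ^ length \<alpha> *\<^sub>C e (\<alpha> @ \<beta>) else 0)"
proof (induction \<alpha>)
  case (Cons i \<alpha>)
  have "blinfun_apply (trunc_shift e P z i) (c *\<^sub>C x) = c *\<^sub>C blinfun_apply (trunc_shift e P z i) x" for c x
    using complex_linear_trunc_shift[of e P z i] by (simp add: complex_linear_def)
  then show ?case
    by (auto simp: Cons trunc_shift_basis scaleC_scaleC mult.commute)
qed (use assms in simp)

text \<open>The family \<open>e\<close> need not span the space, so evaluation on basis vectors is
  not enough. The last letter, however, maps every vector into the span of the
  \<open>e (i # \<gamma>)\<close>, and the at least \<open>P\<close> remaining letters push each of
  these beyond length \<open>P\<close>.\<close>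

lemma op_word_trunc_shift_eq_0:
  assumes "P < length \<alpha>"
  shows "op_word (trunc_shift e P z) \<alpha> = 0"
proof (rule blinfun_eqI)
  fix x
  obtain \<beta> i where \<alpha>: "\<alpha> = \<beta> @ [i]"
    using assms by (cases \<alpha> rule: rev_cases) auto
  have lin: "blinfun_apply (op_word (trunc_shift e P z) \<beta>) (c *\<^sub>C y)
      = c *\<^sub>C blinfun_apply (op_word (trunc_shift e P z) \<beta>) y" for c y
    using complex_linear_op_word[of "trunc_shift e P z" \<beta>, OF complex_linear_trunc_shift]
    by (simp add: complex_linear_def)
  have "blinfun_apply (op_word (trunc_shift e P z) \<beta>) (rank_one (z *\<^sub>C e (i # \<gamma>)) (e \<gamma>) x) = 0"
    if "length \<gamma> < P" for \<gamma>
    using that assms by (simp add: rank_one.rep_eq lin op_word_trunc_shift_basis \<alpha>)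
  then show "blinfun_apply (op_word (trunc_shift e P z) \<alpha>) x = blinfun_apply 0 x"
    by (simp add: \<alpha> op_word_append trunc_shift_def[of _ _ _ i] blinfun.sum_left blinfun.sum_right)
qed

lemma free_eval_trunc_shift:
  "free_eval a (trunc_shift e P z)
    = (\<Sum>\<alpha> | length \<alpha> \<le> P. scalar_op (a \<alpha>) o\<^sub>L op_word (trunc_shift e P z) \<alpha>)"
proof -
  have "(\<Sum>\<alpha> | length \<alpha> = k. scalar_op (a \<alpha>) o\<^sub>L op_word (trunc_shift e P z) \<alpha>) = 0"
    if "k \<notin> {..P}" for k
    using that by (intro sum.neutral) (auto simp: op_word_trunc_shift_eq_0)
  then show ?thesis
    unfolding free_eval_def sum_words_le by (intro suminf_finite) auto
qed

lemma complex_linear_free_eval_trunc_shift: "complex_linear (free_eval a (trunc_shift e P z))"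
  unfolding free_eval_trunc_shift
  by (intro complex_linear_sum complex_linear_compose complex_linear_scalar_op
      complex_linear_op_word complex_linear_trunc_shift)

lemma free_eval_trunc_shift_basis:
  assumes "length \<beta> \<le> P"
  shows "blinfun_apply (free_eval a (trunc_shift e P z)) (e \<beta>)
    = (\<Sum>\<alpha> | length \<alpha> + length \<beta> \<le> P. (a \<alpha> * z ^ length \<alpha>) *\<^sub>C e (\<alpha> @ \<beta>))"
  unfolding free_eval_trunc_shift blinfun.sum_left
  by (rule sum.mono_neutral_cong_right)
    (auto simp: op_word_trunc_shift_basis[OF assms] scalar_op.rep_eq scaleC_scaleC)

text \<open>The adjoints read off, up to the factor \<open>cnj z\<close>, the coefficients of
  \<open>h\<close> at nonempty words. Different pairs \<open>(i, \<alpha>)\<close> give different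
  words, so Bessel's inequality bounds the column.\<close>

lemma trunc_shift_in_ball:
  assumes "cmod z < 1"
  shows "trunc_shift e P z \<in> op_unit_ball"
proof -
  have "(\<Sum>i\<in>UNIV. (norm (blinfun_apply (adj (trunc_shift e P z i)) h))\<^sup>2) \<le> (cmod z)\<^sup>2 * (norm h)\<^sup>2" for h
  proof -
    have "(norm (blinfun_apply (adj (trunc_shift e P z i)) h))\<^sup>2
        = (cmod z)\<^sup>2 * (\<Sum>\<alpha> | length \<alpha> < P. (cmod (cinner h (e (i # \<alpha>))))\<^sup>2)" for i
    proof -
      have "blinfun_apply (adj (trunc_shift e P z i)) h
          = (\<Sum>\<alpha> | length \<alpha> < P. (cnj z * cinner h (e (i # \<alpha>))) *\<^sub>C e \<alpha>)"
        unfolding trunc_shift_def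
        by (subst adj_sum)
          (auto simp: complex_linear_rank_one adj_rank_one blinfun.sum_left rank_one.rep_eq cinner_scaleC_right)
      moreover have "orthonormal e {\<alpha>. length \<alpha> < P}"
        by (rule orthonormal_subset[OF e]) auto
      ultimately show ?thesis
        by (simp add: norm_orthonormal_sum norm_mult power_mult_distrib sum_distrib_left)
    qed
    then have "(\<Sum>i\<in>UNIV. (norm (blinfun_apply (adj (trunc_shift e P z i)) h))\<^sup>2)
        = (cmod z)\<^sup>2 * (\<Sum>i\<in>UNIV. \<Sum>\<alpha> | length \<alpha> < P. (cmod (cinner h (e (i # \<alpha>))))\<^sup>2)"
      by (simp add: sum_distrib_left)
    also have "(\<Sum>i\<in>UNIV. \<Sum>\<alpha> | length \<alpha> < P. (cmod (cinner h (e (i # \<alpha>))))\<^sup>2)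
        = (\<Sum>\<gamma>\<in>(\<lambda>(i, \<alpha>). i # \<alpha>) ` (UNIV \<times> {\<alpha>. length \<alpha> < P}). (cmod (cinner h (e \<gamma>)))\<^sup>2)"
      by (subst sum.reindex) (auto simp: inj_on_def sum.cartesian_product case_prod_unfold)
    also have "\<dots> \<le> (\<Sum>\<gamma> | length \<gamma> \<le> P. (cmod (cinner h (e \<gamma>)))\<^sup>2)"
      by (intro sum_mono2) auto
    also have "\<dots> \<le> (norm h)\<^sup>2"
      by (intro Bessel_inequality e) simp
    finally show ?thesis
      by (simp add: mult_left_mono)
  qed
  then have "norm (\<Sum>i\<in>UNIV. trunc_shift e P z i o\<^sub>L adj (trunc_shift e P z i)) \<le> (cmod z)\<^sup>2"
    by (intro norm_sum_adj_le complex_linear_trunc_shift) auto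
  also have "\<dots> < 1"
    using assms by (simp add: abs_square_less_1)
  finally show ?thesis
    by (simp add: op_unit_ball_def complex_linear_trunc_shift)
qed

end

text \<open>The bilinear form of the row of truncated analytic Toeplitz operators with symbols
  \<open>f\<^sub>j (z S)\<close>.\<close>

definition toeplitz_form :: "('m::finite \<Rightarrow> 'n::finite list \<Rightarrow> complex) \<Rightarrow> nat \<Rightarrow>
    ('m \<Rightarrow> 'n list \<Rightarrow> complex) \<Rightarrow> ('n list \<Rightarrow> complex) \<Rightarrow> complex \<Rightarrow> complex" where
  "toeplitz_form f P g y z = (\<Sum>j\<in>UNIV. \<Sum>\<beta> | length \<beta> \<le> P. \<Sum>\<alpha> | length \<alpha> + length \<beta> \<le> P.
    f j \<alpha> * z ^ length \<alpha> * g j \<beta> * cnj (y (\<alpha> @ \<beta>)))"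

text \<open>The form is the inner product of \<open>R x\<close> with \<open>Y\<close>, where
  \<open>R\<close> is the row of the values of \<open>f\<close> at the truncated shifts and
  \<open>x\<close>, \<open>Y\<close> carry the coefficients \<open>g\<close>, \<open>y\<close>.
  Contractivity gives \<open>norm R \<le> 1\<close>.\<close>

lemma toeplitz_form_bound:
  assumes inf: "infinite_dimensional TYPE('k::complex_hilbert)"
    and contr: "contractive TYPE('k) f" and z: "cmod z < 1"
  shows "cmod (toeplitz_form f P g y z)
    \<le> sqrt (\<Sum>j\<in>UNIV. \<Sum>\<beta> | length \<beta> \<le> P. (cmod (g j \<beta>))\<^sup>2) * sqrt (\<Sum>\<gamma> | length \<gamma> \<le> P. (cmod (y \<gamma>))\<^sup>2)"
proof -
  obtain e :: "'b list \<Rightarrow> 'k" where e: "orthonormal e {\<alpha>. length \<alpha> \<le> P}"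
    using orthonormal_family_exists[OF inf finite_words_le] by blast
  define X where "X = trunc_shift e P z"
  define x where "x = (\<chi> j. \<Sum>\<beta> | length \<beta> \<le> P. g j \<beta> *\<^sub>C e \<beta>)"
  define Y where "Y = (\<Sum>\<gamma> | length \<gamma> \<le> P. y \<gamma> *\<^sub>C e \<gamma>)"
  define R where "R = row_operator (\<lambda>j. free_eval (f j) X)"
  have lin: "blinfun_apply (free_eval (f j) X) (c *\<^sub>C u) = c *\<^sub>C blinfun_apply (free_eval (f j) X) u" for j c u
    using complex_linear_free_eval_trunc_shift[OF e] by (simp add: complex_linear_def X_def)
  have Y: "cinner (e \<gamma>) Y = cnj (y \<gamma>)" if "length \<gamma> \<le> P" for \<gamma>
    using cinner_orthonormal_sum[OF e finite_words_le, of \<gamma> y] that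
    by (simp add: Y_def cinner_commute[of "e \<gamma>"])
  have basis: "cinner (blinfun_apply (free_eval (f j) X) (e \<beta>)) Y
      = (\<Sum>\<alpha> | length \<alpha> + length \<beta> \<le> P. f j \<alpha> * z ^ length \<alpha> * cnj (y (\<alpha> @ \<beta>)))"
    if "length \<beta> \<le> P" for j \<beta>
    by (simp add: X_def free_eval_trunc_shift_basis[OF e that] cinner_sum_left cinner_scaleC_left Y)
  have "cinner (blinfun_apply R x) Y
      = (\<Sum>j\<in>UNIV. \<Sum>\<beta> | length \<beta> \<le> P. g j \<beta> * cinner (blinfun_apply (free_eval (f j) X) (e \<beta>)) Y)"
    by (simp add: R_def x_def row_operator.rep_eq blinfun.sum_right lin cinner_sum_left cinner_scaleC_left)
  also have "\<dots> = toeplitz_form f P g y z"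
    unfolding toeplitz_form_def
    by (intro sum.cong refl) (simp add: basis sum_distrib_left mult_ac)
  finally have "toeplitz_form f P g y z = cinner (blinfun_apply R x) Y"
    by simp
  then have "cmod (toeplitz_form f P g y z) \<le> norm (blinfun_apply R x) * norm Y"
    by (simp add: cinner_Cauchy_Schwarz)
  also have "\<dots> \<le> norm x * norm Y"
  proof (intro mult_right_mono)
    have "norm R \<le> 1"
      using contr trunc_shift_in_ball[OF e z] by (simp add: contractive_def R_def X_def)
    then show "norm (blinfun_apply R x) \<le> norm x"
      using norm_blinfun[of R x] mult_right_mono[of "norm R" 1 "norm x"] by simp
  qed simp
  also have "norm Y = sqrt (\<Sum>\<gamma> | length \<gamma> \<le> P. (cmod (y \<gamma>))\<^sup>2)"
    using norm_orthonormal_sum[OF e finite_words_le, of y] by (simp add: Y_def real_sqrt_unique)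
  also have "norm x = sqrt (\<Sum>j\<in>UNIV. \<Sum>\<beta> | length \<beta> \<le> P. (cmod (g j \<beta>))\<^sup>2)"
    by (simp add: norm_vec_def L2_set_def x_def norm_orthonormal_sum[OF e])
  finally show ?thesis .
qed

text \<open>At \<open>z = 0\<close> only the empty word \<open>\<alpha>\<close> survives (with
  \<open>0 ^ 0 = 1\<close>). Cauchy--Schwarz is then applied first in \<open>j\<close>, which
  produces the norm of \<open>f(0)\<close>, and then in \<open>\<beta>\<close>.\<close>

lemma toeplitz_form_zero_bound:
  "cmod (toeplitz_form f P g y 0) \<le> norm (value_at_zero f) *
    (sqrt (\<Sum>j\<in>UNIV. \<Sum>\<beta> | length \<beta> \<le> P. (cmod (g j \<beta>))\<^sup>2) * sqrt (\<Sum>\<gamma> | length \<gamma> \<le> P. (cmod (y \<gamma>))\<^sup>2))"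
proof -
  define G where "G \<beta> = L2_set (\<lambda>j. cmod (g j \<beta>)) UNIV" for \<beta>
  let ?W = "{\<beta>. length \<beta> \<le> P}"
  have c: "norm (value_at_zero f) = L2_set (\<lambda>j. cmod (f j [])) UNIV"
    by (simp add: value_at_zero_def norm_vec_def)
  have "(\<Sum>\<alpha> | length \<alpha> + length \<beta> \<le> P. f j \<alpha> * 0 ^ length \<alpha> * g j \<beta> * cnj (y (\<alpha> @ \<beta>)))
      = f j [] * g j \<beta> * cnj (y \<beta>)" if "length \<beta> \<le> P" for j \<beta>
  proof -
    have "(\<Sum>\<alpha> | length \<alpha> + length \<beta> \<le> P. f j \<alpha> * 0 ^ length \<alpha> * g j \<beta> * cnj (y (\<alpha> @ \<beta>)))
        = (\<Sum>\<alpha>\<in>{[]}. f j \<alpha> * 0 ^ length \<alpha> * g j \<beta> * cnj (y (\<alpha> @ \<beta>)))"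
      using that by (intro sum.mono_neutral_right) auto
    then show ?thesis
      by simp
  qed
  then have "toeplitz_form f P g y 0 = (\<Sum>\<beta>\<in>?W. \<Sum>j\<in>UNIV. f j [] * g j \<beta> * cnj (y \<beta>))"
    unfolding toeplitz_form_def by (subst sum.swap) simp
  also have "cmod \<dots> \<le> (\<Sum>\<beta>\<in>?W. \<Sum>j\<in>UNIV. cmod (f j []) * cmod (g j \<beta>) * cmod (y \<beta>))"
    by (intro order_trans[OF norm_sum] sum_mono) (simp add: norm_mult)
  also have "\<dots> \<le> (\<Sum>\<beta>\<in>?W. (norm (value_at_zero f) * G \<beta>) * cmod (y \<beta>))"
    unfolding sum_distrib_right[symmetric] c G_def
    using L2_set_mult_ineq[of "\<lambda>j. cmod (f j [])" "\<lambda>j. cmod (g j _)" UNIV]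
    by (intro sum_mono mult_right_mono) auto
  also have "\<dots> = norm (value_at_zero f) * (\<Sum>\<beta>\<in>?W. \<bar>G \<beta>\<bar> * \<bar>cmod (y \<beta>)\<bar>)"
    by (simp add: sum_distrib_left mult.assoc G_def L2_set_nonneg)
  also have "\<dots> \<le> norm (value_at_zero f) * (L2_set G ?W * L2_set (\<lambda>\<beta>. cmod (y \<beta>)) ?W)"
    by (intro mult_left_mono L2_set_mult_ineq) simp
  also have "L2_set G ?W = sqrt (\<Sum>j\<in>UNIV. \<Sum>\<beta>\<in>?W. (cmod (g j \<beta>))\<^sup>2)"
    by (subst sum.swap) (simp add: L2_set_def G_def sum_nonneg)
  finally show ?thesis
    by (simp add: L2_set_def)
qed

section \<open>Uniform strict contraction at radius \<open>r\<close>\<close>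

definition contraction_factor :: "real \<Rightarrow> real \<Rightarrow> real" where
  "contraction_factor c r = sqrt (1 - (1 - c) * (1 - r\<^sup>2) / 2)"

text \<open>The radicand is the Schwarz--Pick bound; it lies in \<open>[0, 1)\<close> because
  \<open>(1 - c) (1 - r^2)\<close> lies in \<open>(0, 1]\<close>.\<close>

lemma contraction_factor:
  assumes "0 \<le> c" "c < 1" "0 \<le> r" "r < 1"
  shows "0 \<le> contraction_factor c r" "contraction_factor c r < 1"
    "(contraction_factor c r)\<^sup>2 = 1 - (1 - c) * (1 - r\<^sup>2) / 2"
proof -
  have r: "0 < 1 - r\<^sup>2" "1 - r\<^sup>2 \<le> 1"
    using assms by (auto simp: abs_square_less_1)
  then have "(1 - c) * (1 - r\<^sup>2) \<le> 1 * 1" "0 < (1 - c) * (1 - r\<^sup>2)"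
    using assms by (intro mult_mono mult_pos_pos; simp)+
  then show "0 \<le> contraction_factor c r" "contraction_factor c r < 1"
    "(contraction_factor c r)\<^sup>2 = 1 - (1 - c) * (1 - r\<^sup>2) / 2"
    by (simp_all add: contraction_factor_def)
qed

text \<open>Fixing the test vectors turns the operator estimate into a scalar one in
  \<open>z\<close>. The factor does not depend on \<open>P\<close>, \<open>g\<close> or
  \<open>y\<close>, so it bounds all truncations simultaneously.\<close>

lemma toeplitz_form_strict_bound:
  assumes inf: "infinite_dimensional TYPE('k::complex_hilbert)"
    and contr: "contractive TYPE('k) f" and c: "norm (value_at_zero f) < 1" and r: "0 \<le> r" "r < 1"
  shows "cmod (toeplitz_form f P g y (complex_of_real r))
    \<le> contraction_factor (norm (value_at_zero f)) r *
      (sqrt (\<Sum>j\<in>UNIV. \<Sum>\<beta> | length \<beta> \<le> P. (cmod (g j \<beta>))\<^sup>2) * sqrt (\<Sum>\<gamma> | length \<gamma> \<le> P. (cmod (y \<gamma>))\<^sup>2))"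
    (is "_ \<le> ?\<rho> * ?B")
proof (cases "?B = 0")
  case True
  have "cmod (toeplitz_form f P g y (complex_of_real r)) \<le> ?B"
    using r by (intro toeplitz_form_bound[OF inf contr]) simp
  then show ?thesis
    unfolding True by simp
next
  case False
  define B where "B = ?B"
  have "0 \<le> B"
    unfolding B_def by (intro mult_nonneg_nonneg) (auto intro!: sum_nonneg)
  with False have B: "0 < B"
    by (simp add: B_def less_le)
  note \<rho> = contraction_factor[OF norm_ge_zero c r]
  \<comment> \<open>The form is a polynomial in \<open>z\<close>; division by \<open>B\<close>
    normalises it to a map of the disc into the closed disc, with value at 0 of modulus at most the
    norm of \<open>f(0)\<close>.\<close>
  define \<phi> where "\<phi> z = toeplitz_form f P g y z / complex_of_real B" for z
  have "(cmod (\<phi> (complex_of_real r)))\<^sup>2 \<le> 1 - (1 - norm (value_at_zero f)) * (1 - r\<^sup>2) / 2"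
  proof (rule Schwarz_Pick_bound[where \<phi> = \<phi>])
    show "\<phi> holomorphic_on ball 0 1"
      unfolding \<phi>_def toeplitz_form_def using B by (intro holomorphic_intros) auto
    show "cmod (\<phi> z) \<le> 1" if "cmod z < 1" for z
      using toeplitz_form_bound[OF inf contr that, of P g y, folded B_def] B
      by (simp add: \<phi>_def norm_divide)
    show "cmod (\<phi> 0) \<le> norm (value_at_zero f)"
      using toeplitz_form_zero_bound[of f P g y, folded B_def] B
      by (simp add: \<phi>_def norm_divide divide_le_eq)
  qed (use r in auto)
  then have "cmod (\<phi> (complex_of_real r)) \<le> ?\<rho>"
    using \<rho> by (metis power2_le_imp_le)
  then have "cmod (toeplitz_form f P g y (complex_of_real r)) \<le> ?\<rho> * B"
    using B by (simp add: \<phi>_def norm_divide divide_le_eq)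
  then show ?thesis
    by (simp only: B_def)
qed

text \<open>Passage to the adjoint by duality: with \<open>g\<close> the adjoint row applied to
  \<open>y\<close>, the form equals the squared norm \<open>S\<close> of \<open>g\<close>, and one
  factor \<open>sqrt S\<close> cancels.\<close>

lemma toeplitz_adjoint_bound:
  assumes "infinite_dimensional TYPE('k::complex_hilbert)"
    and "contractive TYPE('k) f" and "norm (value_at_zero f) < 1" and "0 \<le> r" "r < 1"
  shows "(\<Sum>j\<in>UNIV. \<Sum>\<beta> | length \<beta> \<le> P.
      (cmod (\<Sum>\<alpha> | length \<alpha> + length \<beta> \<le> P. cnj (f j \<alpha>) * complex_of_real r ^ length \<alpha> * y (\<alpha> @ \<beta>)))\<^sup>2)
    \<le> (contraction_factor (norm (value_at_zero f)) r)\<^sup>2 * (\<Sum>\<gamma> | length \<gamma> \<le> P. (cmod (y \<gamma>))\<^sup>2)"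
    (is "?S \<le> ?\<rho>\<^sup>2 * ?Y")
proof -
  define g where "g j \<beta> =
    (\<Sum>\<alpha> | length \<alpha> + length \<beta> \<le> P. cnj (f j \<alpha>) * complex_of_real r ^ length \<alpha> * y (\<alpha> @ \<beta>))" for j \<beta>
  define S where "S = (\<Sum>j\<in>UNIV. \<Sum>\<beta> | length \<beta> \<le> P. (cmod (g j \<beta>))\<^sup>2)"
  define Y where "Y = ?Y"
  have S0: "0 \<le> S" and Y0: "0 \<le> Y"
    by (auto simp: S_def Y_def intro!: sum_nonneg)
  have cnj_g: "cnj (g j \<beta>) =
    (\<Sum>\<alpha> | length \<alpha> + length \<beta> \<le> P. f j \<alpha> * complex_of_real r ^ length \<alpha> * cnj (y (\<alpha> @ \<beta>)))" for j \<beta>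
    by (simp add: g_def)
  have "toeplitz_form f P g y (complex_of_real r)
      = (\<Sum>j\<in>UNIV. \<Sum>\<beta> | length \<beta> \<le> P. g j \<beta> * cnj (g j \<beta>))"
    unfolding toeplitz_form_def cnj_g sum_distrib_left by (intro sum.cong refl) (simp only: mult_ac)
  also have "\<dots> = complex_of_real S"
    by (simp only: S_def of_real_sum complex_norm_square)
  finally have "S = cmod (toeplitz_form f P g y (complex_of_real r))"
    using S0 by simp
  also have "\<dots> \<le> ?\<rho> * (sqrt S * sqrt Y)"
    using toeplitz_form_strict_bound[OF assms, of P g y] by (simp only: S_def Y_def)
  finally have le: "sqrt S * sqrt S \<le> (?\<rho> * sqrt Y) * sqrt S"
    using S0 by (simp add: mult_ac)
  have "sqrt S \<le> ?\<rho> * sqrt Y"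
  proof (cases "S = 0")
    case False
    with S0 le show ?thesis
      by (intro mult_right_le_imp_le[OF le]) simp
  qed (use Y0 contraction_factor(1)[OF norm_ge_zero assms(3-5)] in simp)
  then have "(sqrt S)\<^sup>2 \<le> (?\<rho> * sqrt Y)\<^sup>2"
    using S0 by (intro power_mono) auto
  then have "S \<le> ?\<rho>\<^sup>2 * Y"
    using S0 Y0 by (simp add: power_mult_distrib)
  then show ?thesis
    by (simp only: S_def Y_def g_def)
qed

text \<open>Vectors in place of scalars: expand in an orthonormal basis of the span of the \<open>v \<gamma>\<close>.\<close>

lemma toeplitz_adjoint_bound_vector:
  fixes f :: "'m::finite \<Rightarrow> 'n::finite list \<Rightarrow> complex" and v :: "'n list \<Rightarrow> 'h::complex_hilbert"
  assumes "infinite_dimensional TYPE('k::complex_hilbert)"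
    and "contractive TYPE('k) f" and "norm (value_at_zero f) < 1" and "0 \<le> r" "r < 1"
  shows "(\<Sum>j\<in>UNIV. \<Sum>\<beta> | length \<beta> \<le> P.
      (norm (\<Sum>\<alpha> | length \<alpha> + length \<beta> \<le> P. (cnj (f j \<alpha>) * complex_of_real r ^ length \<alpha>) *\<^sub>C v (\<alpha> @ \<beta>)))\<^sup>2)
    \<le> (contraction_factor (norm (value_at_zero f)) r)\<^sup>2 * (\<Sum>\<gamma> | length \<gamma> \<le> P. (norm (v \<gamma>))\<^sup>2)"
    (is "?S \<le> ?\<rho>\<^sup>2 * ?V")
proof -
  let ?W = "{\<gamma>::'n list. length \<gamma> \<le> P}"
  obtain U where U: "finite U" "orthonormal (\<lambda>u. u) U"
    and exp: "\<And>\<gamma>. length \<gamma> \<le> P \<Longrightarrow> v \<gamma> = (\<Sum>u\<in>U. cinner (v \<gamma>) u *\<^sub>C u)"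
    using finite_orthonormal_basis[of "v ` ?W"] by auto
  let ?s = "\<lambda>u j \<beta>. \<Sum>\<alpha> | length \<alpha> + length \<beta> \<le> P. cnj (f j \<alpha>) * complex_of_real r ^ length \<alpha> * cinner (v (\<alpha> @ \<beta>)) u"
  have "(\<Sum>\<alpha> | length \<alpha> + length \<beta> \<le> P. (cnj (f j \<alpha>) * complex_of_real r ^ length \<alpha>) *\<^sub>C v (\<alpha> @ \<beta>))
      = (\<Sum>u\<in>U. ?s u j \<beta> *\<^sub>C u)" for j \<beta>
  proof -
    have "(\<Sum>\<alpha> | length \<alpha> + length \<beta> \<le> P. (cnj (f j \<alpha>) * complex_of_real r ^ length \<alpha>) *\<^sub>C v (\<alpha> @ \<beta>))
      = (\<Sum>\<alpha> | length \<alpha> + length \<beta> \<le> P. \<Sum>u\<in>U.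
          (cnj (f j \<alpha>) * complex_of_real r ^ length \<alpha> * cinner (v (\<alpha> @ \<beta>)) u) *\<^sub>C u)"
    proof (intro sum.cong refl)
      fix \<alpha> :: "'n list" assume "\<alpha> \<in> {\<alpha>. length \<alpha> + length \<beta> \<le> P}"
      then have "v (\<alpha> @ \<beta>) = (\<Sum>u\<in>U. cinner (v (\<alpha> @ \<beta>)) u *\<^sub>C u)"
        by (intro exp) simp
      then have "(cnj (f j \<alpha>) * complex_of_real r ^ length \<alpha>) *\<^sub>C v (\<alpha> @ \<beta>)
          = (cnj (f j \<alpha>) * complex_of_real r ^ length \<alpha>) *\<^sub>C (\<Sum>u\<in>U. cinner (v (\<alpha> @ \<beta>)) u *\<^sub>C u)"
        by (rule arg_cong)
      then show "(cnj (f j \<alpha>) * complex_of_real r ^ length \<alpha>) *\<^sub>C v (\<alpha> @ \<beta>) = (\<Sum>u\<in>U.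
          (cnj (f j \<alpha>) * complex_of_real r ^ length \<alpha> * cinner (v (\<alpha> @ \<beta>)) u) *\<^sub>C u)"
        by (simp only: scaleC_sum_right scaleC_scaleC)
    qed
    also have "\<dots> = (\<Sum>u\<in>U. ?s u j \<beta> *\<^sub>C u)"
      by (subst sum.swap) (simp only: scaleC_sum_left)
    finally show ?thesis .
  qed
  \<comment> \<open>By Parseval both sides split into sums over \<open>U\<close>, and the scalar
    bound applies for each \<open>u\<close> separately.\<close>
  then have "?S = (\<Sum>j\<in>UNIV. \<Sum>\<beta>\<in>?W. \<Sum>u\<in>U. (cmod (?s u j \<beta>))\<^sup>2)"
    by (simp only: norm_orthonormal_sum[OF U(2,1)])
  also have "\<dots> = (\<Sum>u\<in>U. \<Sum>j\<in>UNIV. \<Sum>\<beta>\<in>?W. (cmod (?s u j \<beta>))\<^sup>2)"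
    by (simp only: sum.swap[of _ U ?W]) (rule sum.swap)
  also have "\<dots> \<le> (\<Sum>u\<in>U. ?\<rho>\<^sup>2 * (\<Sum>\<gamma>\<in>?W. (cmod (cinner (v \<gamma>) u))\<^sup>2))"
    by (intro sum_mono toeplitz_adjoint_bound[OF assms])
  also have "\<dots> = ?\<rho>\<^sup>2 * (\<Sum>\<gamma>\<in>?W. \<Sum>u\<in>U. (cmod (cinner (v \<gamma>) u))\<^sup>2)"
    by (subst sum.swap) (simp only: sum_distrib_left)
  also have "(\<Sum>\<gamma>\<in>?W. \<Sum>u\<in>U. (cmod (cinner (v \<gamma>) u))\<^sup>2) = ?V"
  proof (intro sum.cong refl)
    fix \<gamma> assume "\<gamma> \<in> ?W"
    then have "norm (v \<gamma>) = norm (\<Sum>u\<in>U. cinner (v \<gamma>) u *\<^sub>C u)"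
      by (intro arg_cong[where f = norm] exp) simp
    then show "(\<Sum>u\<in>U. (cmod (cinner (v \<gamma>) u))\<^sup>2) = (norm (v \<gamma>))\<^sup>2"
      by (simp only: norm_orthonormal_sum[OF U(2,1)])
  qed
  finally show ?thesis .
qed


section \<open>Joint spectral radius\<close>

text \<open>Completeness passes to the operator space, so norm dominated series of operators
  converge.\<close>

instance complex_hilbert \<subseteq> banach ..

lemma complex_linear_adj: "complex_linear A \<Longrightarrow> complex_linear (adj A)"
  unfolding complex_linear_def[of "adj A"]
  by (intro allI cinner_eqI) (simp add: cinner_scaleC_right flip: cinner_adj)

lemma sum_words_append:
  "(\<Sum>\<gamma> :: 'n::finite list | length \<gamma> = k + l. F \<gamma>)
    = (\<Sum>\<alpha> | length \<alpha> = k. \<Sum>\<beta> | length \<beta> = l. F (\<alpha> @ \<beta>))"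
  unfolding sum.cartesian_product
  by (rule sum.reindex_bij_witness[of _ "\<lambda>(\<alpha>, \<beta>). \<alpha> @ \<beta>" "\<lambda>\<gamma>. (take k \<gamma>, drop k \<gamma>)"]) auto

lemma sum_words_Suc:
  "(\<Sum>\<gamma> :: 'n::finite list | length \<gamma> = Suc k. F \<gamma>)
    = (\<Sum>i\<in>UNIV. \<Sum>\<beta> | length \<beta> = k. F (i # \<beta>))"
  unfolding sum.cartesian_product
  by (rule sum.reindex_bij_witness[of _ "\<lambda>(i, \<beta>). i # \<beta>" "\<lambda>\<gamma>. (hd \<gamma>, tl \<gamma>)"])
    (auto simp: length_Suc_conv)

section \<open>Submultiplicativity and existence of the spectral radius limit\<close>

definition word_norm :: "('n::finite \<Rightarrow> 'h \<Rightarrow>\<^sub>L 'h::complex_hilbert) \<Rightarrow> nat \<Rightarrow> real" where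
  "word_norm T k = norm (\<Sum>\<alpha> | length \<alpha> = k. op_word T \<alpha> o\<^sub>L adj (op_word T \<alpha>))"

lemma word_norm_nonneg [simp]: "0 \<le> word_norm T k"
  by (simp add: word_norm_def)

lemma sum_norm_adj_word_le:
  assumes "\<And>i. complex_linear (T i)"
  shows "(\<Sum>\<alpha> | length \<alpha> = k. (norm (blinfun_apply (adj (op_word T \<alpha>)) h))\<^sup>2) \<le> word_norm T k * (norm h)\<^sup>2"
  unfolding word_norm_def by (intro sum_norm_adj_le complex_linear_op_word assms)

text \<open>The adjoint of a word splits as the adjoint of \<open>\<beta>\<close> applied after that
  of \<open>\<alpha>\<close>; the sum over \<open>\<beta>\<close> is bounded first, at the vectors
  produced by the \<open>\<alpha>\<close>.\<close>

lemma word_norm_add_le: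
  assumes T: "\<And>i. complex_linear (T i)"
  shows "word_norm T (k + l) \<le> word_norm T k * word_norm T l"
  unfolding word_norm_def[of T "k + l"]
proof (rule norm_sum_adj_le)
  fix h
  have "(\<Sum>\<gamma> | length \<gamma> = k + l. (norm (blinfun_apply (adj (op_word T \<gamma>)) h))\<^sup>2)
      = (\<Sum>\<alpha> | length \<alpha> = k. \<Sum>\<beta> | length \<beta> = l.
          (norm (blinfun_apply (adj (op_word T \<beta>)) (blinfun_apply (adj (op_word T \<alpha>)) h)))\<^sup>2)"
    by (simp add: sum_words_append op_word_append adj_compose complex_linear_op_word T)
  also have "\<dots> \<le> (\<Sum>\<alpha> | length \<alpha> = k. word_norm T l * (norm (blinfun_apply (adj (op_word T \<alpha>)) h))\<^sup>2)"
    by (intro sum_mono sum_norm_adj_word_le T)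
  also have "\<dots> \<le> word_norm T l * (word_norm T k * (norm h)\<^sup>2)"
    unfolding sum_distrib_left[symmetric] by (intro mult_left_mono sum_norm_adj_word_le T) simp
  finally show "(\<Sum>\<gamma> | length \<gamma> = k + l. (norm (blinfun_apply (adj (op_word T \<gamma>)) h))\<^sup>2)
      \<le> word_norm T k * word_norm T l * (norm h)\<^sup>2"
    by (simp add: mult_ac)
qed (auto intro: complex_linear_op_word T)

text \<open>Replaces the bare \<open>lim\<close> by genuine convergence, from Fekete's lemma and
  continuity of the square root.\<close>

lemma joint_spectral_radius_LIMSEQ:
  assumes "\<And>i. complex_linear (T i)"
  shows "(\<lambda>k. root (2 * k) (word_norm T k)) \<longlonglongrightarrow> joint_spectral_radius T"
proof -
  have "convergent (\<lambda>k. root k (word_norm T k))"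
    by (intro submultiplicative_root_convergent word_norm_add_le assms) simp
  then obtain L where "(\<lambda>k. root k (word_norm T k)) \<longlonglongrightarrow> L"
    by (auto simp: convergent_def)
  then have "(\<lambda>k. sqrt (root k (word_norm T k))) \<longlonglongrightarrow> sqrt L"
    by (rule tendsto_real_sqrt)
  then have "convergent (\<lambda>k. root (2 * k) (word_norm T k))"
    unfolding real_root_mult_exp sqrt_def by (auto simp: convergent_def)
  then show ?thesis
    unfolding joint_spectral_radius_def word_norm_def by (simp add: convergent_LIMSEQ_iff)
qed

lemma eventually_word_norm_le:
  assumes "\<And>i. complex_linear (T i)" "joint_spectral_radius T < q"
  shows "\<forall>\<^sub>F k in sequentially. word_norm T k \<le> q ^ (2 * k)"
  using order_tendstoD(2)[OF joint_spectral_radius_LIMSEQ[of T, OF assms(1)] assms(2)]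
    eventually_ge_at_top[of 1]
proof eventually_elim
  case (elim k)
  then have "root (2 * k) (word_norm T k) ^ (2 * k) \<le> q ^ (2 * k)"
    by (intro power_mono) auto
  then show ?case
    using elim by (simp add: real_root_pow_pos2)
qed

text \<open>Rota's renorming criterion: it suffices that the column of adjoints contracts some Hilbertian
  norm \<open>\<surd>Q\<close> equivalent to the given one.\<close>

lemma joint_spectral_radius_le:
  fixes F :: "'m::finite \<Rightarrow> 'h \<Rightarrow>\<^sub>L 'h::complex_hilbert"
  assumes F: "\<And>j. complex_linear (F j)" and \<rho>: "0 \<le> \<rho>"
    and lower: "\<And>h. (norm h)\<^sup>2 \<le> Q h" and upper: "\<And>h. Q h \<le> C * (norm h)\<^sup>2"
    and contract: "\<And>h. (\<Sum>j\<in>UNIV. Q (blinfun_apply (adj (F j)) h)) \<le> \<rho>\<^sup>2 * Q h"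
  shows "joint_spectral_radius F \<le> \<rho>"
proof -
  have words: "(\<Sum>\<beta> | length \<beta> = k. Q (blinfun_apply (adj (op_word F \<beta>)) h)) \<le> (\<rho>\<^sup>2) ^ k * Q h" for k h
  proof (induction k arbitrary: h)
    case (Suc k)
    have "(\<Sum>\<beta> | length \<beta> = Suc k. Q (blinfun_apply (adj (op_word F \<beta>)) h))
        = (\<Sum>j\<in>UNIV. \<Sum>\<beta> | length \<beta> = k. Q (blinfun_apply (adj (op_word F \<beta>)) (blinfun_apply (adj (F j)) h)))"
      by (simp add: sum_words_Suc adj_compose complex_linear_op_word F)
    also have "\<dots> \<le> (\<Sum>j\<in>UNIV. (\<rho>\<^sup>2) ^ k * Q (blinfun_apply (adj (F j)) h))"
      by (intro sum_mono Suc)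
    also have "\<dots> \<le> (\<rho>\<^sup>2) ^ k * (\<rho>\<^sup>2 * Q h)"
      unfolding sum_distrib_left[symmetric] by (intro mult_left_mono contract) simp
    finally show ?case
      by (simp add: mult_ac)
  qed simp
  \<comment> \<open>On the zero space \<open>C\<close> may be any number; a positive constant is
    needed for \<open>root k D\<close> to tend to 1.\<close>
  define D where "D = max C 1"
  have D: "0 < D" "C \<le> D"
    by (auto simp: D_def)
  have bound: "word_norm F k \<le> \<rho> ^ (2 * k) * D" for k
    unfolding word_norm_def
  proof (rule norm_sum_adj_le)
    fix h
    have "(\<Sum>\<beta> | length \<beta> = k. (norm (blinfun_apply (adj (op_word F \<beta>)) h))\<^sup>2)
        \<le> (\<Sum>\<beta> | length \<beta> = k. Q (blinfun_apply (adj (op_word F \<beta>)) h))"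
      by (intro sum_mono lower)
    also have "\<dots> \<le> (\<rho>\<^sup>2) ^ k * Q h"
      by (rule words)
    also have "\<dots> \<le> (\<rho>\<^sup>2) ^ k * (D * (norm h)\<^sup>2)"
      using D by (intro mult_left_mono order_trans[OF upper] mult_right_mono) auto
    finally show "(\<Sum>\<beta> | length \<beta> = k. (norm (blinfun_apply (adj (op_word F \<beta>)) h))\<^sup>2)
        \<le> \<rho> ^ (2 * k) * D * (norm h)\<^sup>2"
      by (simp add: power_mult mult.assoc)
  qed (use F D \<rho> in \<open>auto intro: complex_linear_op_word\<close>)
  have "(\<lambda>k. root k D) \<longlonglongrightarrow> 1"
    by (rule LIMSEQ_root_const[OF D(1)])
  then have "(\<lambda>k. \<rho> * sqrt (root k D)) \<longlonglongrightarrow> \<rho> * sqrt 1"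
    by (intro tendsto_intros)
  moreover have "root (2 * k) (word_norm F k) \<le> \<rho> * sqrt (root k D)" if "1 \<le> k" for k
  proof -
    have "root (2 * k) (word_norm F k) \<le> root (2 * k) (\<rho> ^ (2 * k) * D)"
      using that by (intro real_root_le_mono bound) auto
    also have "\<dots> = \<rho> * root (2 * k) D"
      using that \<rho> by (simp add: real_root_mult real_root_power_cancel)
    also have "\<dots> = \<rho> * sqrt (root k D)"
      by (simp only: real_root_mult_exp sqrt_def)
    finally show ?thesis .
  qed
  ultimately show ?thesis
    using LIMSEQ_le[OF joint_spectral_radius_LIMSEQ[of F, OF F]] by auto
qed

section \<open>Convergence of the free power series\<close>

definition homogeneous_part ::
  "('n::finite list \<Rightarrow> complex) \<Rightarrow> ('n \<Rightarrow> 'h \<Rightarrow>\<^sub>L 'h::complex_hilbert) \<Rightarrow> nat \<Rightarrow> 'h \<Rightarrow>\<^sub>L 'h" where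
  "homogeneous_part a T k = (\<Sum>\<alpha> | length \<alpha> = k. scalar_op (a \<alpha>) o\<^sub>L op_word T \<alpha>)"

lemma complex_linear_homogeneous_part:
  "(\<And>i. complex_linear (T i)) \<Longrightarrow> complex_linear (homogeneous_part a T k)"
  unfolding homogeneous_part_def
  by (intro complex_linear_sum complex_linear_compose complex_linear_scalar_op complex_linear_op_word)

lemma adj_homogeneous_part:
  assumes "\<And>i. complex_linear (T i)"
  shows "blinfun_apply (adj (homogeneous_part a T k)) h
    = (\<Sum>\<alpha> | length \<alpha> = k. cnj (a \<alpha>) *\<^sub>C blinfun_apply (adj (op_word T \<alpha>)) h)"
proof -
  have lin: "blinfun_apply (adj (op_word T \<alpha>)) (c *\<^sub>C x) = c *\<^sub>C blinfun_apply (adj (op_word T \<alpha>)) x" for \<alpha> c x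
    using complex_linear_adj[OF complex_linear_op_word[of T, OF assms]] by (simp add: complex_linear_def)
  show ?thesis
    unfolding homogeneous_part_def
    by (subst adj_sum)
      (auto simp: complex_linear_compose complex_linear_scalar_op complex_linear_op_word assms
        adj_compose adj_scalar_op blinfun.sum_left scalar_op.rep_eq lin)
qed

text \<open>Cauchy--Schwarz over the words of length \<open>k\<close>, carried out for the adjoint
  because \<open>word_norm\<close> controls the column of adjoints; \<open>|y|^2\<close> is then the
  inner product of \<open>x\<close> with the adjoint applied to \<open>y\<close>.\<close>

lemma norm_homogeneous_part_le:
  assumes T: "\<And>i. complex_linear (T i)"
  shows "norm (homogeneous_part a T k) \<le> sqrt (\<Sum>\<alpha> | length \<alpha> = k. (cmod (a \<alpha>))\<^sup>2) * sqrt (word_norm T k)"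
proof (rule norm_blinfun_bound)
  let ?A = "homogeneous_part a T k" and ?W = "{\<alpha>. length \<alpha> = k}"
  let ?s = "sqrt (\<Sum>\<alpha>\<in>?W. (cmod (a \<alpha>))\<^sup>2)"
  fix x
  define y where "y = blinfun_apply ?A x"
  have "norm (blinfun_apply (adj ?A) y) \<le> (\<Sum>\<alpha>\<in>?W. \<bar>cmod (a \<alpha>)\<bar> * \<bar>norm (blinfun_apply (adj (op_word T \<alpha>)) y)\<bar>)"
    unfolding adj_homogeneous_part[where T = T, OF T] by (intro order_trans[OF norm_sum]) (simp add: norm_scaleC)
  also have "\<dots> \<le> ?s * sqrt (\<Sum>\<alpha>\<in>?W. (norm (blinfun_apply (adj (op_word T \<alpha>)) y))\<^sup>2)"
    using L2_set_mult_ineq[of "\<lambda>\<alpha>. cmod (a \<alpha>)" "\<lambda>\<alpha>. norm (blinfun_apply (adj (op_word T \<alpha>)) y)" ?W]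
    by (simp only: L2_set_def)
  also have "\<dots> \<le> ?s * sqrt (word_norm T k * (norm y)\<^sup>2)"
    by (intro mult_left_mono real_sqrt_le_mono sum_norm_adj_word_le T) (auto intro!: sum_nonneg)
  also have "\<dots> = ?s * sqrt (word_norm T k) * norm y"
    by (simp add: real_sqrt_mult)
  finally have adj_le: "norm (blinfun_apply (adj ?A) y) \<le> ?s * sqrt (word_norm T k) * norm y" .
  have "norm y * norm y = inner x (blinfun_apply (adj ?A) y)"
    by (simp add: y_def power2_norm_eq_inner inner_eq_Re_cinner
        cinner_adj[OF complex_linear_homogeneous_part[where T = T, OF T]] flip: power2_eq_square)
  also have "\<dots> \<le> norm x * norm (blinfun_apply (adj ?A) y)"
    by (rule norm_cauchy_schwarz)
  also have "\<dots> \<le> norm x * (?s * sqrt (word_norm T k) * norm y)"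
    by (intro mult_left_mono adj_le) simp
  finally have "norm y * norm y \<le> (?s * sqrt (word_norm T k) * norm x) * norm y"
    by (simp only: mult_ac)
  then show "norm y \<le> ?s * sqrt (word_norm T k) * norm x"
    by (cases "y = 0") (auto intro!: mult_nonneg_nonneg sum_nonneg)
qed (auto intro!: mult_nonneg_nonneg sum_nonneg)

text \<open>Cauchy--Hadamard: the coefficients of a series with radius of convergence at least 1
  eventually grow no faster than \<open>(1 / r) ^ k\<close>.\<close>

lemma eventually_coeff_le:
  assumes "free_holomorphic a" and r: "0 < r" "r < 1"
  shows "\<forall>\<^sub>F k in sequentially. (\<Sum>\<alpha> | length \<alpha> = k. (cmod (a \<alpha>))\<^sup>2) \<le> (1 / r) ^ (2 * k)"
proof -
  have "limsup (\<lambda>k. ereal (root (2 * k) (\<Sum>\<alpha> | length \<alpha> = k. (cmod (a \<alpha>))\<^sup>2))) < ereal (1 / r)"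
    using assms(1) unfolding free_holomorphic_def
    by (rule le_less_trans) (use r in \<open>simp add: one_ereal_def\<close>)
  from Limsup_lessD[OF this] eventually_ge_at_top[of 1] show ?thesis
  proof eventually_elim
    case (elim k)
    let ?s = "\<Sum>\<alpha> | length \<alpha> = k. (cmod (a \<alpha>))\<^sup>2"
    have s: "0 \<le> ?s"
      by (auto intro: sum_nonneg)
    have "root (2 * k) ?s ^ (2 * k) \<le> (1 / r) ^ (2 * k)"
      using elim s by (intro power_mono) auto
    then show ?case
      using elim s by (simp add: real_root_pow_pos2)
  qed
qed

text \<open>For \<open>q < r\<close> between the spectral radius and 1, growth
  \<open>(1 / r) ^ k\<close> of the coefficients against decay \<open>q ^ k\<close> of the words
  leaves a geometric series.\<close>

lemma free_eval_sums:
  assumes T: "\<And>i. complex_linear (T i)" and "free_holomorphic a" and "joint_spectral_radius T < 1"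
  shows "homogeneous_part a T sums free_eval a T"
proof -
  obtain q where q: "max 0 (joint_spectral_radius T) < q" "q < 1"
    using dense[of "max 0 (joint_spectral_radius T)" 1] assms(3) by auto
  obtain r where r: "q < r" "r < 1"
    using dense[OF q(2)] by auto
  have "\<forall>\<^sub>F k in sequentially. (\<Sum>\<alpha> | length \<alpha> = k. (cmod (a \<alpha>))\<^sup>2) \<le> (1 / r) ^ (2 * k)"
    using q r by (intro eventually_coeff_le assms(2)) auto
  moreover have "\<forall>\<^sub>F k in sequentially. word_norm T k \<le> q ^ (2 * k)"
    using q by (intro eventually_word_norm_le T) auto
  ultimately have "\<forall>\<^sub>F k in sequentially. norm (homogeneous_part a T k) \<le> (q / r) ^ k"
  proof eventually_elim
    case (elim k)
    have "norm (homogeneous_part a T k)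
        \<le> sqrt (\<Sum>\<alpha> | length \<alpha> = k. (cmod (a \<alpha>))\<^sup>2) * sqrt (word_norm T k)"
      by (rule norm_homogeneous_part_le[where T = T, OF T])
    also have "\<dots> \<le> sqrt ((1 / r) ^ (2 * k)) * sqrt (q ^ (2 * k))"
      using elim by (intro mult_mono real_sqrt_le_mono) (auto intro!: sum_nonneg)
    also have "\<dots> = (q / r) ^ k"
      using q r by (simp add: power_mult[of _ 2 k] power_mult real_sqrt_power power_divide real_sqrt_divide)
    finally show ?case .
  qed
  then have "summable (homogeneous_part a T)"
    by (rule summable_comparison_test_ev) (use q r in \<open>simp add: summable_geometric\<close>)
  then show ?thesis
    unfolding free_eval_def homogeneous_part_def[symmetric] by (rule summable_sums)
qed

lemma complex_linear_free_eval:
  assumes "\<And>i. complex_linear (T i)" "free_holomorphic a" "joint_spectral_radius T < 1"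
  shows "complex_linear (free_eval a T)"
  using free_eval_sums[of T, OF assms] unfolding sums_def
  by (rule complex_linear_lim[rotated])
    (intro complex_linear_sum complex_linear_homogeneous_part assms(1))

section \<open>From the Toeplitz bound to the joint spectral radius\<close>

theorem theorem4p10:
  fixes f :: "'m::finite \<Rightarrow> 'n::finite list \<Rightarrow> complex"
    and T :: "'n \<Rightarrow> 'h \<Rightarrow>\<^sub>L 'h::complex_hilbert"
  assumes "separable_space (euclidean :: 'k::complex_hilbert topology)"
    and "infinite_dimensional TYPE('k)"
    and "\<forall>j. free_holomorphic (f j)"
    and "contractive TYPE('k) f"
    and "norm (value_at_zero f) < 1"
    and "\<forall>j. \<exists>F\<in>disc_algebra. has_boundary_function (f j) F"
    and "\<forall>i. complex_linear (T i)"
    and "joint_spectral_radius T < 1"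
  shows "joint_spectral_radius (\<lambda>j. free_eval (f j) T) < 1"
proof -
  have T: "complex_linear (T i)" for i
    using assms(7) by blast
  have f: "free_holomorphic (f j)" for j
    using assms(3) by blast
  \<comment> \<open>Two radii: \<open>q\<close> governs the decay of \<open>word_norm T\<close>,
    while the larger \<open>r\<close> weights the new norm, so that its series is dominated by
    powers of \<open>(q / r)^2\<close>. The maximum with 0 makes both positive.\<close>
  obtain q where q: "max 0 (joint_spectral_radius T) < q" "q < 1"
    using dense[of "max 0 (joint_spectral_radius T)" 1] assms(8) by auto
  obtain r where r: "q < r" "r < 1"
    using dense[OF q(2)] by auto
  have r0: "0 < r"
    using q r by simp
  define \<rho> where "\<rho> = contraction_factor (norm (value_at_zero f)) r"
  have \<rho>: "0 \<le> \<rho>" "\<rho> < 1"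
    using contraction_factor[of "norm (value_at_zero f)" r] assms(5) r r0 by (auto simp: \<rho>_def)
  define Ta where "Ta \<alpha> = blinfun_apply (adj (op_word T \<alpha>))" for \<alpha>
  have Ta_append: "Ta (\<alpha> @ \<beta>) h = Ta \<beta> (Ta \<alpha> h)" for \<alpha> \<beta> h
    by (simp add: Ta_def op_word_append adj_compose complex_linear_op_word T)
  have Ta_scaleC: "Ta \<alpha> (c *\<^sub>C h) = c *\<^sub>C Ta \<alpha> h" for \<alpha> c h
    using complex_linear_adj[OF complex_linear_op_word[of T, OF T]]
    by (simp add: Ta_def complex_linear_def)
  \<comment> \<open>\<open>v h\<close> is the image of \<open>h\<close> in the tensor product of
    Fock space with H, and \<open>t h k\<close> is the squared norm of its part of degree
    \<open>k\<close>.\<close>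
  define v where "v h \<gamma> = complex_of_real (1 / r ^ length \<gamma>) *\<^sub>C Ta \<gamma> h" for h \<gamma>
  define t where "t h k = (\<Sum>\<gamma> | length \<gamma> = k. (norm (v h \<gamma>))\<^sup>2)" for h k
  have t_nonneg: "0 \<le> t h k" for h k
    by (auto simp: t_def intro!: sum_nonneg)
  have t_le: "t h k \<le> word_norm T k / r ^ (2 * k) * (norm h)\<^sup>2" for h k
  proof -
    have "t h k = (\<Sum>\<gamma> | length \<gamma> = k. (norm (Ta \<gamma> h))\<^sup>2) / r ^ (2 * k)"
      unfolding t_def sum_divide_distrib using r0
      by (intro sum.cong)
        (auto simp: v_def norm_scaleC norm_divide norm_power power_divide power_even_eq)
    also have "\<dots> \<le> word_norm T k * (norm h)\<^sup>2 / r ^ (2 * k)"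
      unfolding Ta_def using r0 by (intro divide_right_mono sum_norm_adj_word_le T) auto
    finally show ?thesis
      by simp
  qed
  have summable_w: "summable (\<lambda>k. word_norm T k / r ^ (2 * k))"
  proof (rule summable_comparison_test_ev)
    show "\<forall>\<^sub>F k in sequentially. norm (word_norm T k / r ^ (2 * k)) \<le> ((q / r)\<^sup>2) ^ k"
      using eventually_word_norm_le[where T = T and q = q, OF T] q
      by (auto elim!: eventually_mono simp: power_divide divide_right_mono r0 simp flip: power_mult)
    have "(q / r)\<^sup>2 < 1"
      using q r by (simp add: abs_square_less_1)
    then show "summable (\<lambda>k. ((q / r)\<^sup>2) ^ k)"
      by (simp add: summable_geometric)
  qed
  have summable_t: "summable (t h)" for h
    by (rule summable_comparison_test'[OF summable_mult2[OF summable_w, of "(norm h)\<^sup>2"]])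
      (use t_le t_nonneg in auto)
  define Q where "Q h = (\<Sum>k. t h k)" for h
  define C where "C = (\<Sum>k. word_norm T k / r ^ (2 * k))"
  have lower: "(norm h)\<^sup>2 \<le> Q h" for h
  proof -
    have "t h 0 = (norm h)\<^sup>2"
      by (simp add: t_def v_def Ta_def)
    then show ?thesis
      using sum_le_suminf[OF summable_t, of "{0}" h] t_nonneg by (simp add: Q_def)
  qed
  have upper: "Q h \<le> C * (norm h)\<^sup>2" for h
    unfolding Q_def C_def suminf_mult2[OF summable_w]
    by (intro suminf_le t_le summable_t summable_mult2 summable_w)
  have t_sum: "(\<Sum>\<gamma> | length \<gamma> \<le> P. (norm (v h \<gamma>))\<^sup>2) = (\<Sum>k\<le>P. t h k)" for h P
    unfolding t_def by (rule sum_words_le)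
  have sum_le_Q: "(\<Sum>k\<le>P. t h k) \<le> Q h" for h P
    unfolding Q_def by (intro sum_le_suminf summable_t t_nonneg) auto

  \<comment> \<open>The intertwining relation for the adjoints\<close>
  define Fa where "Fa j = blinfun_apply (adj (free_eval (f j) T))" for j
  have Fa_lim: "(\<lambda>n. \<Sum>\<alpha> | length \<alpha> < n. cnj (f j \<alpha>) *\<^sub>C Ta \<alpha> h) \<longlonglongrightarrow> Fa j h" for j h
  proof -
    have "(\<lambda>n. blinfun_apply (adj (\<Sum>k<n. homogeneous_part (f j) T k)) h) \<longlonglongrightarrow> Fa j h"
      unfolding Fa_def using free_eval_sums[where T = T, OF T f assms(8)]
      by (intro tendsto_intros adj_lim complex_linear_sum complex_linear_homogeneous_part T)
        (simp add: sums_def)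
    moreover have "blinfun_apply (adj (\<Sum>k<n. homogeneous_part (f j) T k)) h
        = (\<Sum>\<alpha> | length \<alpha> < n. cnj (f j \<alpha>) *\<^sub>C Ta \<alpha> h)" for n
    proof -
      have "blinfun_apply (adj (\<Sum>k<n. homogeneous_part (f j) T k)) h
          = (\<Sum>k<n. \<Sum>\<alpha> | length \<alpha> = k. cnj (f j \<alpha>) *\<^sub>C Ta \<alpha> h)"
        by (subst adj_sum)
          (auto simp: complex_linear_homogeneous_part T blinfun.sum_left adj_homogeneous_part Ta_def)
      also have "\<dots> = (\<Sum>k<n. \<Sum>\<alpha> | \<alpha> \<in> {\<alpha>. length \<alpha> < n} \<and> length \<alpha> = k. cnj (f j \<alpha>) *\<^sub>C Ta \<alpha> h)"
        by (intro sum.cong) auto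
      also have "\<dots> = (\<Sum>\<alpha> | length \<alpha> < n. cnj (f j \<alpha>) *\<^sub>C Ta \<alpha> h)"
        by (rule sum.group) auto
      finally show ?thesis .
    qed
    ultimately show ?thesis
      by simp
  qed
  \<comment> \<open>The weight \<open>r ^ length \<alpha>\<close> of the Toeplitz operator cancels
    the \<open>\<alpha>\<close> part of the weight of \<open>v h (\<alpha> @ \<beta>)\<close>. What
    remains is the adjoint of the word \<open>\<beta>\<close> applied to partial sums for
    \<open>Fa j h\<close>.\<close>
  have v_lim: "(\<lambda>P. \<Sum>\<alpha> | length \<alpha> + length \<beta> \<le> P.
      (cnj (f j \<alpha>) * complex_of_real r ^ length \<alpha>) *\<^sub>C v h (\<alpha> @ \<beta>)) \<longlonglongrightarrow> v (Fa j h) \<beta>" for j h \<beta>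
  proof -
    let ?c = "complex_of_real (1 / r ^ length \<beta>)"
    have summand: "(cnj (f j \<alpha>) * complex_of_real r ^ length \<alpha>) *\<^sub>C v h (\<alpha> @ \<beta>)
        = ?c *\<^sub>C Ta \<beta> (cnj (f j \<alpha>) *\<^sub>C Ta \<alpha> h)" for \<alpha>
      using r0 by (simp add: v_def Ta_append Ta_scaleC scaleC_scaleC power_add field_simps)
    have "(\<lambda>n. ?c *\<^sub>C Ta \<beta> (\<Sum>\<alpha> | length \<alpha> < n. cnj (f j \<alpha>) *\<^sub>C Ta \<alpha> h)) \<longlonglongrightarrow> ?c *\<^sub>C Ta \<beta> (Fa j h)"
      unfolding Ta_def[of \<beta>]
      by (intro bounded_linear.tendsto[OF bounded_linear_scaleC]
          bounded_linear.tendsto[OF blinfun.bounded_linear_right] Fa_lim)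
    then have "(\<lambda>n. \<Sum>\<alpha> | length \<alpha> < n. (cnj (f j \<alpha>) * complex_of_real r ^ length \<alpha>) *\<^sub>C v h (\<alpha> @ \<beta>))
        \<longlonglongrightarrow> v (Fa j h) \<beta>"
      by (simp only: summand v_def[of "Fa j h"] Ta_def[of \<beta>] blinfun.sum_right scaleC_sum_right)
    then have "(\<lambda>n. \<Sum>\<alpha> | length \<alpha> < Suc n. (cnj (f j \<alpha>) * complex_of_real r ^ length \<alpha>) *\<^sub>C v h (\<alpha> @ \<beta>))
        \<longlonglongrightarrow> v (Fa j h) \<beta>"
      by (rule LIMSEQ_Suc)
    then show ?thesis
      \<comment> \<open>At \<open>P = n + length \<beta>\<close> the cut-off is
        \<open>length \<alpha> \<le> n\<close>, that is
        \<open>length \<alpha> < Suc n\<close>.\<close>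
      by - (rule LIMSEQ_offset[where k = "length \<beta>"], simp add: less_Suc_eq_le)
  qed
  have partial: "(\<Sum>j\<in>UNIV. \<Sum>k\<le>M. t (Fa j h) k) \<le> \<rho>\<^sup>2 * Q h" for h M
  \<comment> \<open>Two cut-offs are used. With \<open>M\<close> fixed, only finitely many limits
    \<open>P\<close> to infinity are taken; for \<open>P \<ge> M\<close> the sum up to
    \<open>M\<close> is at most the sum up to \<open>P\<close>, where the Toeplitz bound
    holds.\<close>
  proof (rule LIMSEQ_le_const2)
    show "(\<lambda>P. \<Sum>j\<in>UNIV. \<Sum>\<beta> | length \<beta> \<le> M. (norm (\<Sum>\<alpha> | length \<alpha> + length \<beta> \<le> P.
        (cnj (f j \<alpha>) * complex_of_real r ^ length \<alpha>) *\<^sub>C v h (\<alpha> @ \<beta>)))\<^sup>2)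
        \<longlonglongrightarrow> (\<Sum>j\<in>UNIV. \<Sum>k\<le>M. t (Fa j h) k)"
      unfolding t_sum[symmetric] by (intro tendsto_intros v_lim)
    have "(\<Sum>j\<in>UNIV. \<Sum>\<beta> | length \<beta> \<le> M. (norm (\<Sum>\<alpha> | length \<alpha> + length \<beta> \<le> P.
        (cnj (f j \<alpha>) * complex_of_real r ^ length \<alpha>) *\<^sub>C v h (\<alpha> @ \<beta>)))\<^sup>2) \<le> \<rho>\<^sup>2 * Q h"
      if "M \<le> P" for P
    proof -
      have "(\<Sum>j\<in>UNIV. \<Sum>\<beta> | length \<beta> \<le> M. (norm (\<Sum>\<alpha> | length \<alpha> + length \<beta> \<le> P.
          (cnj (f j \<alpha>) * complex_of_real r ^ length \<alpha>) *\<^sub>C v h (\<alpha> @ \<beta>)))\<^sup>2)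
        \<le> (\<Sum>j\<in>UNIV. \<Sum>\<beta> | length \<beta> \<le> P. (norm (\<Sum>\<alpha> | length \<alpha> + length \<beta> \<le> P.
          (cnj (f j \<alpha>) * complex_of_real r ^ length \<alpha>) *\<^sub>C v h (\<alpha> @ \<beta>)))\<^sup>2)"
        using that by (intro sum_mono sum_mono2) auto
      also have "\<dots> \<le> \<rho>\<^sup>2 * (\<Sum>\<gamma> | length \<gamma> \<le> P. (norm (v h \<gamma>))\<^sup>2)"
        unfolding \<rho>_def using r r0 by (intro toeplitz_adjoint_bound_vector[OF assms(2,4,5)]) auto
      also have "\<dots> \<le> \<rho>\<^sup>2 * Q h"
        unfolding t_sum by (intro mult_left_mono sum_le_Q) simp
      finally show ?thesis .
    qed
    then show "\<exists>N. \<forall>P\<ge>N. (\<Sum>j\<in>UNIV. \<Sum>\<beta> | length \<beta> \<le> M. (norm (\<Sum>\<alpha> | length \<alpha> + length \<beta> \<le> P.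
        (cnj (f j \<alpha>) * complex_of_real r ^ length \<alpha>) *\<^sub>C v h (\<alpha> @ \<beta>)))\<^sup>2) \<le> \<rho>\<^sup>2 * Q h"
      by blast
  qed
  have contract: "(\<Sum>j\<in>UNIV. Q (Fa j h)) \<le> \<rho>\<^sup>2 * Q h" for h
  \<comment> \<open>Now \<open>M\<close> tends to infinity, the bound being independent of
    \<open>M\<close>.\<close>
  proof (rule LIMSEQ_le_const2)
    show "(\<lambda>M. \<Sum>j\<in>UNIV. \<Sum>k\<le>M. t (Fa j h) k) \<longlonglongrightarrow> (\<Sum>j\<in>UNIV. Q (Fa j h))"
      unfolding Q_def by (intro tendsto_sum summable_LIMSEQ' summable_t)
  qed (use partial in blast)
  have "joint_spectral_radius (\<lambda>j. free_eval (f j) T) \<le> \<rho>"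
    by (rule joint_spectral_radius_le[where F = "\<lambda>j. free_eval (f j) T", OF complex_linear_free_eval[where T = T, OF T f assms(8)] \<rho>(1) lower upper])
      (use contract in \<open>simp add: Fa_def\<close>)
  with \<rho>(2) show ?thesis
    by simp
qed

end
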